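(* The idempotent completion $\widetilde{\square^{\mathrm{nat}}_{*,*}}$ of the category $\square^{\mathrm{nat}}_{*,*}$ of naturally bipointed cubes, regarded as the full subcategory of $\mathsf{sCat}_{\omega,*,*}$ on the bipointed retracts of naturally bipointed cubes, is closed in $\mathsf{sCat}_{\omega,*,*}$ under suspensions and wedge sums: if $X,Y\in\widetilde{\square^{\mathrm{nat}}_{*,*}}$ then $\Sigma X\in\widetilde{\square^{\mathrm{nat}}_{*,*}}$ and $X\vee Y\in\widetilde{\square^{\mathrm{nat}}_{*,*}}$.
   Context: $\mathsf{sCat}_\omega$ is the 1-category of strict $\omega$-categories and strict functors. $\otimes^{\mathrm{lax}}$ is the (lax) Gray tensor product, a biclosed monoidal structure on $\mathsf{sCat}_\omega$; it is the essentially unique such structure which, on $\omega$-categories $\nu(K),\nu(L)$ associated to augmented directed complexes $K,L$ with strongly loop-free unital bases (Steiner complexes), is given by $\nu(K\otimes L)$, with $K\otimes L$ the usual tensor product of chain complexes, $d(x\otimes y)=dx\otimes y+(-1)^{|x|}x\otimes dy$, with basis the products of basis elements. Its unit is the terminal $\omega$-category $\square^0$. $\square^1=\{0\to1\}$ is the arrow category, and $\square^n=(\square^1)^{\otimes^{\mathrm{lax}}n}$ is the $n$-cube. The objects of $\square^n$ are the elements of $\{0,1\}^n$; write $\vec0=(0,\dots,0)$, $\vec1=(1,\dots,1)$. $\mathsf{sCat}_{\omega,*,*}$ is the category of bipointed strict $\omega$-categories: strict $\omega$-categories with an ordered pair of objects (first and second point), with functors preserving both points. The natural bipointing of $\square^n$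 is $(\vec0,\vec1)$, and $\square^{\mathrm{nat}}_{*,*}\subset\mathsf{sCat}_{\omega,*,*}$ is the full subcategory on the naturally bipointed cubes $\square^n$, $n\in\mathbb{N}$. For bipointed $C,D$, the wedge sum $C\vee D$ is the pushout $C\cup_{\square^0}D$ in $\mathsf{sCat}_\omega$ gluing the second point of $C$ to the first point of $D$, bipointed by the first point of $C$ and the second point of $D$. The suspension $\Sigma C$ (which ignores the bipointing of $C$) has two objects $0,1$ with $\mathrm{Hom}(0,0)=\mathrm{Hom}(1,1)=\square^0$, $\mathrm{Hom}(1,0)=\emptyset$, $\mathrm{Hom}(0,1)=C$, and is bipointed by $(0,1)$. *)

theory Defs
  imports Main "HOL-Library.Poly_Mapping"
begin

section \<open>Strict \<open>\<omega>\<close>-categories\<close>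

text \<open>
  Strict \<open>\<omega>\<close>-categories in their one-sorted presentation (Street, Steiner): an \<open>n\<close>-cell is
  identified with its identity \<open>(n+1)\<close>-cell, so that there is one set of cells.  The \<open>n\<close>-cells are the
  cells fixed by the \<open>n\<close>-boundary operators; the objects are the \<open>0\<close>-cells.  In \<open>bd C s n x\<close> the sign
  \<open>s\<close> is \<open>False\<close> for the source and \<open>True\<close> for the target.  Composition is written
  in diagrammatic order: \<open>gcomp C n x y\<close> is meaningful when \<open>tgt C n x = src C n y\<close>.
\<close>

record 'a omega =
  cells :: "'a set"
  bd :: "bool \<Rightarrow> nat \<Rightarrow> 'a \<Rightarrow> 'a"
  gcomp :: "nat \<Rightarrow> 'a \<Rightarrow> 'a \<Rightarrow> 'a"

abbreviation src :: "('a, 'm) omega_scheme \<Rightarrow> nat \<Rightarrow> 'a \<Rightarrow> 'a" where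
  "src C \<equiv> bd C False"

abbreviation tgt :: "('a, 'm) omega_scheme \<Rightarrow> nat \<Rightarrow> 'a \<Rightarrow> 'a" where
  "tgt C \<equiv> bd C True"

definition objects :: "('a, 'm) omega_scheme \<Rightarrow> 'a set" where
  "objects C = {x \<in> cells C. src C 0 x = x}"

locale omega_category =
  fixes C :: "('a, 'm) omega_scheme"
  assumes bd_closed: "x \<in> cells C \<Longrightarrow> bd C s n x \<in> cells C"
    and comp_closed: "\<lbrakk>x \<in> cells C; y \<in> cells C; tgt C n x = src C n y\<rbrakk> \<Longrightarrow> gcomp C n x y \<in> cells C"
    and bd_bd_less: "\<lbrakk>x \<in> cells C; m < n\<rbrakk> \<Longrightarrow> bd C s m (bd C s' n x) = bd C s m x"
    and bd_bd_ge: "\<lbrakk>x \<in> cells C; n \<le> m\<rbrakk> \<Longrightarrow> bd C s m (bd C s' n x) = bd C s' n x"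
    and src_comp: "\<lbrakk>x \<in> cells C; y \<in> cells C; tgt C n x = src C n y\<rbrakk> \<Longrightarrow> src C n (gcomp C n x y) = src C n x"
    and tgt_comp: "\<lbrakk>x \<in> cells C; y \<in> cells C; tgt C n x = src C n y\<rbrakk> \<Longrightarrow> tgt C n (gcomp C n x y) = tgt C n y"
    and bd_comp_less: "\<lbrakk>x \<in> cells C; y \<in> cells C; tgt C n x = src C n y; m < n\<rbrakk>
          \<Longrightarrow> bd C s m (gcomp C n x y) = bd C s m x"
    and bd_comp_greater: "\<lbrakk>x \<in> cells C; y \<in> cells C; tgt C n x = src C n y; n < m\<rbrakk>
          \<Longrightarrow> bd C s m (gcomp C n x y) = gcomp C n (bd C s m x) (bd C s m y)"
    and unit_left: "x \<in> cells C \<Longrightarrow> gcomp C n (src C n x) x = x"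
    and unit_right: "x \<in> cells C \<Longrightarrow> gcomp C n x (tgt C n x) = x"
    and assoc: "\<lbrakk>x \<in> cells C; y \<in> cells C; z \<in> cells C; tgt C n x = src C n y; tgt C n y = src C n z\<rbrakk>
          \<Longrightarrow> gcomp C n (gcomp C n x y) z = gcomp C n x (gcomp C n y z)"
    and interchange: "\<lbrakk>x \<in> cells C; x' \<in> cells C; y \<in> cells C; y' \<in> cells C; m < n;
            tgt C n x = src C n x'; tgt C n y = src C n y';
            tgt C m x = src C m y; tgt C m x' = src C m y'\<rbrakk>
          \<Longrightarrow> gcomp C m (gcomp C n x x') (gcomp C n y y') = gcomp C n (gcomp C m x y) (gcomp C m x' y')"
    and finite_dim: "x \<in> cells C \<Longrightarrow> \<exists>n. src C n x = x"

text \<open>Preservation of identities is automatic here, as identities are not separate cells.\<close>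

definition strict_functor ::
    "('a \<Rightarrow> 'b) \<Rightarrow> ('a, 'm) omega_scheme \<Rightarrow> ('b, 'k) omega_scheme \<Rightarrow> bool" where
  "strict_functor F C D \<longleftrightarrow>
     (\<forall>x\<in>cells C. F x \<in> cells D) \<and>
     (\<forall>x\<in>cells C. \<forall>s n. F (bd C s n x) = bd D s n (F x)) \<and>
     (\<forall>x\<in>cells C. \<forall>y\<in>cells C. \<forall>n. tgt C n x = src C n y \<longrightarrow>
        F (gcomp C n x y) = gcomp D n (F x) (F y))"

definition terminal_omega :: "unit omega" where
  "terminal_omega = \<lparr>cells = UNIV, bd = (\<lambda>_ _ x. x), gcomp = (\<lambda>_ x _. x)\<rparr>"

definition hom_omega :: "('a, 'm) omega_scheme \<Rightarrow> 'a \<Rightarrow> 'a \<Rightarrow> 'a omega" where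
  "hom_omega C a b = \<lparr>cells = {x \<in> cells C. src C 0 x = a \<and> tgt C 0 x = b},
     bd = (\<lambda>s n. bd C s (Suc n)), gcomp = (\<lambda>n. gcomp C (Suc n))\<rparr>"


section \<open>Bipointed strict \<open>\<omega>\<close>-categories\<close>

record 'a bip_omega = "'a omega" +
  pt0 :: 'a
  pt1 :: 'a

definition bipoint :: "'a omega \<Rightarrow> 'a \<Rightarrow> 'a \<Rightarrow> 'a bip_omega" where
  "bipoint C a b = \<lparr>cells = cells C, bd = bd C, gcomp = gcomp C, pt0 = a, pt1 = b\<rparr>"

lemma bipoint_simps [simp]:
  "cells (bipoint C a b) = cells C" "bd (bipoint C a b) = bd C" "gcomp (bipoint C a b) = gcomp C"
  "pt0 (bipoint C a b) = a" "pt1 (bipoint C a b) = b"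
  by (simp_all add: bipoint_def)

lemma omega_category_bipoint [simp]: "omega_category (bipoint C a b) \<longleftrightarrow> omega_category C"
  by (simp add: omega_category_def)

definition bipointed :: "'a bip_omega \<Rightarrow> bool" where
  "bipointed C \<longleftrightarrow> omega_category C \<and> pt0 C \<in> objects C \<and> pt1 C \<in> objects C"

definition bip_functor :: "('a \<Rightarrow> 'b) \<Rightarrow> 'a bip_omega \<Rightarrow> 'b bip_omega \<Rightarrow> bool" where
  "bip_functor F C D \<longleftrightarrow> strict_functor F C D \<and> F (pt0 C) = pt0 D \<and> F (pt1 C) = pt1 D"

definition bip_retract :: "'a bip_omega \<Rightarrow> 'b bip_omega \<Rightarrow> bool" where
  "bip_retract X Y \<longleftrightarrow> (\<exists>i r. bip_functor i X Y \<and> bip_functor r Y X \<and> (\<forall>x\<in>cells X. r (i x) = x))"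


section \<open>Suspension\<close>

datatype 'a susp_cell = Susp0 | Susp1 | SuspCell 'a

fun susp_bd :: "('a, 'm) omega_scheme \<Rightarrow> bool \<Rightarrow> nat \<Rightarrow> 'a susp_cell \<Rightarrow> 'a susp_cell" where
  "susp_bd C s 0 (SuspCell x) = (if s then Susp1 else Susp0)"
| "susp_bd C s (Suc n) (SuspCell x) = SuspCell (bd C s n x)"
| "susp_bd C s n Susp0 = Susp0"
| "susp_bd C s n Susp1 = Susp1"

text \<open>
  The only composites in which one factor is \<open>Susp0\<close> or \<open>Susp1\<close> are unit composites.  The last
  equation for \<open>0\<close>-composition concerns non-composable pairs only.
\<close>

fun susp_comp :: "('a, 'm) omega_scheme \<Rightarrow> nat \<Rightarrow> 'a susp_cell \<Rightarrow> 'a susp_cell \<Rightarrow> 'a susp_cell" where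
  "susp_comp C n Susp0 y = y"
| "susp_comp C n Susp1 y = y"
| "susp_comp C n (SuspCell x) Susp0 = SuspCell x"
| "susp_comp C n (SuspCell x) Susp1 = SuspCell x"
| "susp_comp C (Suc n) (SuspCell x) (SuspCell y) = SuspCell (gcomp C n x y)"
| "susp_comp C 0 (SuspCell x) (SuspCell y) = SuspCell x"

definition suspension :: "('a, 'm) omega_scheme \<Rightarrow> 'a susp_cell bip_omega" where
  "suspension C = \<lparr>cells = {Susp0, Susp1} \<union> SuspCell ` cells C,
     bd = susp_bd C, gcomp = susp_comp C, pt0 = Susp0, pt1 = Susp1\<rparr>"

lemma suspension_bipointed:
  assumes "omega_category C"
  shows "bipointed (suspension C)"
proof -
  interpret omega_category C by fact
  have "omega_category (suspension C)"
  proof (unfold_locales, goal_cases)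
    case (1 x s n) then show ?case
      by (cases x; cases n) (auto simp: suspension_def bd_closed)
  next
    case (2 x y n) then show ?case
      by (cases x; cases y; cases n) (auto simp: suspension_def comp_closed)
  next
    case (3 x m n s s') then show ?case
      by (cases x; cases n; cases m) (auto simp: suspension_def bd_bd_less)
  next
    case (4 x n m s s') then show ?case
      by (cases x; cases n; cases m) (auto simp: suspension_def bd_bd_ge)
  next
    case (5 x y n) then show ?case
      by (cases x; cases y; cases n) (auto simp: suspension_def src_comp)
  next
    case (6 x y n) then show ?case
      by (cases x; cases y; cases n) (auto simp: suspension_def tgt_comp)
  next
    case (7 x y n m s) then show ?case
      by (cases x; cases y; cases n; cases m) (auto simp: suspension_def bd_comp_less)
  next
    case (8 x y n m s) then show ?case
      by (cases x; cases y; cases n; cases m) (auto simp: suspension_def bd_comp_greater)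
  next
    case (9 x n) then show ?case
      by (cases x; cases n) (auto simp: suspension_def unit_left)
  next
    case (10 x n) then show ?case
      by (cases x; cases n) (auto simp: suspension_def unit_right)
  next
    case (11 x y z n)
    show ?case
    proof (cases n)
      case 0 with 11 show ?thesis by (cases x; cases y; cases z) (auto simp: suspension_def)
    next
      case (Suc k) with 11 show ?thesis by (cases x; cases y; cases z) (auto simp: suspension_def assoc)
    qed
  next
    case (12 x x' y y' m n)
    then obtain k where n: "n = Suc k" by (cases n) auto
    show ?case
    proof (cases m)
      case 0 with 12 n show ?thesis by (cases x; cases y; simp add: suspension_def; cases x'; cases y'; auto)
    next
      case (Suc k) with 12 n show ?thesis by (cases x; cases y; simp add: suspension_def; cases x'; cases y'; auto simp: interchange)
    qed
  next
    case (13 x)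
    show ?case
    proof (cases x)
      case (SuspCell c)
      with 13 obtain n where "src C n c = c" using finite_dim by (auto simp: suspension_def)
      then show ?thesis
        using SuspCell by (intro exI[of _ "Suc n"]) (simp add: suspension_def)
    qed (simp_all add: suspension_def)
  qed
  then show ?thesis
    by (auto simp: bipointed_def objects_def suspension_def)
qed

lemma objects_suspension: "objects (suspension C) = {Susp0, Susp1}"
  by (auto simp: objects_def suspension_def)

lemma suspension_homs:
  shows "cells (hom_omega (suspension C) Susp0 Susp0) = {Susp0}"
    and "cells (hom_omega (suspension C) Susp1 Susp1) = {Susp1}"
    and "cells (hom_omega (suspension C) Susp1 Susp0) = {}"
    and "strict_functor SuspCell C (hom_omega (suspension C) Susp0 Susp1)"
    and "bij_betw SuspCell (cells C) (cells (hom_omega (suspension C) Susp0 Susp1))"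
  by (auto simp: hom_omega_def suspension_def strict_functor_def bij_betw_def inj_on_def)


section \<open>Pushouts and wedge sums\<close>

text \<open>
  The pushout of \<open>f : A \<rightarrow> C\<close> and \<open>g : A \<rightarrow> D\<close> is the strict \<open>\<omega>\<close>-category presented by
  the cells of \<open>C\<close> and of \<open>D\<close>, subject to the relations holding in \<open>C\<close> and in \<open>D\<close> and to
  \<open>f c = g c\<close>.  Its cells are classes of formal terms.  The relation \<open>po_eq\<close> is a partial
  equivalence relation: \<open>po_eq A f g C D t t\<close> says that \<open>t\<close> is well formed, i.e. that all
  the composites occurring in it are defined in the pushout.
\<close>

datatype ('a, 'b) po_term =
    InL 'a
  | InR 'b
  | Bd bool nat "('a, 'b) po_term"
  | Cmp nat "('a, 'b) po_term" "('a, 'b) po_term"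

inductive po_eq ::
  "('c, 'm) omega_scheme \<Rightarrow> ('c \<Rightarrow> 'a) \<Rightarrow> ('c \<Rightarrow> 'b) \<Rightarrow> ('a, 'k) omega_scheme \<Rightarrow> ('b, 'l) omega_scheme
     \<Rightarrow> ('a, 'b) po_term \<Rightarrow> ('a, 'b) po_term \<Rightarrow> bool"
  for A f g C D
where
  inl: "x \<in> cells C \<Longrightarrow> po_eq A f g C D (InL x) (InL x)"
| inr: "y \<in> cells D \<Longrightarrow> po_eq A f g C D (InR y) (InR y)"
| inl_bd: "x \<in> cells C \<Longrightarrow> po_eq A f g C D (Bd s n (InL x)) (InL (bd C s n x))"
| inr_bd: "y \<in> cells D \<Longrightarrow> po_eq A f g C D (Bd s n (InR y)) (InR (bd D s n y))"
| inl_comp: "\<lbrakk>x \<in> cells C; x' \<in> cells C; tgt C n x = src C n x'\<rbrakk>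
    \<Longrightarrow> po_eq A f g C D (Cmp n (InL x) (InL x')) (InL (gcomp C n x x'))"
| inr_comp: "\<lbrakk>y \<in> cells D; y' \<in> cells D; tgt D n y = src D n y'\<rbrakk>
    \<Longrightarrow> po_eq A f g C D (Cmp n (InR y) (InR y')) (InR (gcomp D n y y'))"
| glue: "c \<in> cells A \<Longrightarrow> po_eq A f g C D (InL (f c)) (InR (g c))"
| sym: "po_eq A f g C D t u \<Longrightarrow> po_eq A f g C D u t"
| trans: "\<lbrakk>po_eq A f g C D t u; po_eq A f g C D u v\<rbrakk> \<Longrightarrow> po_eq A f g C D t v"
| bd_cong: "po_eq A f g C D t u \<Longrightarrow> po_eq A f g C D (Bd s n t) (Bd s n u)"
| comp_cong: "\<lbrakk>po_eq A f g C D t t'; po_eq A f g C D u u'; po_eq A f g C D (Bd True n t) (Bd False n u)\<rbrakk>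
    \<Longrightarrow> po_eq A f g C D (Cmp n t u) (Cmp n t' u')"
| bd_bd_less: "\<lbrakk>po_eq A f g C D t t; m < n\<rbrakk> \<Longrightarrow> po_eq A f g C D (Bd s m (Bd s' n t)) (Bd s m t)"
| bd_bd_ge: "\<lbrakk>po_eq A f g C D t t; n \<le> m\<rbrakk> \<Longrightarrow> po_eq A f g C D (Bd s m (Bd s' n t)) (Bd s' n t)"
| src_comp: "\<lbrakk>po_eq A f g C D t t; po_eq A f g C D u u; po_eq A f g C D (Bd True n t) (Bd False n u)\<rbrakk>
    \<Longrightarrow> po_eq A f g C D (Bd False n (Cmp n t u)) (Bd False n t)"
| tgt_comp: "\<lbrakk>po_eq A f g C D t t; po_eq A f g C D u u; po_eq A f g C D (Bd True n t) (Bd False n u)\<rbrakk>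
    \<Longrightarrow> po_eq A f g C D (Bd True n (Cmp n t u)) (Bd True n u)"
| bd_comp_less: "\<lbrakk>po_eq A f g C D t t; po_eq A f g C D u u; po_eq A f g C D (Bd True n t) (Bd False n u); m < n\<rbrakk>
    \<Longrightarrow> po_eq A f g C D (Bd s m (Cmp n t u)) (Bd s m t)"
| bd_comp_greater: "\<lbrakk>po_eq A f g C D t t; po_eq A f g C D u u; po_eq A f g C D (Bd True n t) (Bd False n u); n < m\<rbrakk>
    \<Longrightarrow> po_eq A f g C D (Bd s m (Cmp n t u)) (Cmp n (Bd s m t) (Bd s m u))"
| unit_left: "po_eq A f g C D t t \<Longrightarrow> po_eq A f g C D (Cmp n (Bd False n t) t) t"
| unit_right: "po_eq A f g C D t t \<Longrightarrow> po_eq A f g C D (Cmp n t (Bd True n t)) t"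
| assoc: "\<lbrakk>po_eq A f g C D t t; po_eq A f g C D u u; po_eq A f g C D v v;
      po_eq A f g C D (Bd True n t) (Bd False n u); po_eq A f g C D (Bd True n u) (Bd False n v)\<rbrakk>
    \<Longrightarrow> po_eq A f g C D (Cmp n (Cmp n t u) v) (Cmp n t (Cmp n u v))"
| interchange: "\<lbrakk>po_eq A f g C D t t; po_eq A f g C D t' t'; po_eq A f g C D u u; po_eq A f g C D u' u'; m < n;
      po_eq A f g C D (Bd True n t) (Bd False n t'); po_eq A f g C D (Bd True n u) (Bd False n u');
      po_eq A f g C D (Bd True m t) (Bd False m u); po_eq A f g C D (Bd True m t') (Bd False m u')\<rbrakk>
    \<Longrightarrow> po_eq A f g C D (Cmp m (Cmp n t t') (Cmp n u u')) (Cmp n (Cmp m t u) (Cmp m t' u'))"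

definition po_class ::
  "('c, 'm) omega_scheme \<Rightarrow> ('c \<Rightarrow> 'a) \<Rightarrow> ('c \<Rightarrow> 'b) \<Rightarrow> ('a, 'k) omega_scheme \<Rightarrow> ('b, 'l) omega_scheme
     \<Rightarrow> ('a, 'b) po_term \<Rightarrow> ('a, 'b) po_term set" where
  "po_class A f g C D t = {u. po_eq A f g C D t u}"

definition pushout ::
  "('c, 'm) omega_scheme \<Rightarrow> ('c \<Rightarrow> 'a) \<Rightarrow> ('c \<Rightarrow> 'b) \<Rightarrow> ('a, 'k) omega_scheme \<Rightarrow> ('b, 'l) omega_scheme
     \<Rightarrow> ('a, 'b) po_term set omega" where
  "pushout A f g C D = \<lparr>
     cells = po_class A f g C D ` {t. po_eq A f g C D t t},
     bd = (\<lambda>s n P. \<Union>t\<in>P. po_class A f g C D (Bd s n t)),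
     gcomp = (\<lambda>n P Q. \<Union>t\<in>P. \<Union>u\<in>Q. po_class A f g C D (Cmp n t u))\<rparr>"

lemma po_classI: "po_eq A f g C D t u \<Longrightarrow> po_class A f g C D t = po_class A f g C D u"
  unfolding po_class_def by (blast intro: po_eq.sym po_eq.trans)

lemma po_class_eq_iff:
  assumes "po_eq A f g C D u u"
  shows "po_class A f g C D t = po_class A f g C D u \<longleftrightarrow> po_eq A f g C D t u"
  using assms po_classI unfolding po_class_def by blast

lemma po_refl: "po_eq A f g C D t u \<Longrightarrow> po_eq A f g C D t t"
  by (rule po_eq.trans, assumption, rule po_eq.sym)

lemma pushout_cells: "P \<in> cells (pushout A f g C D) \<longleftrightarrow> (\<exists>t. po_eq A f g C D t t \<and> P = po_class A f g C D t)"
  by (auto simp: pushout_def)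

lemma pushout_bd:
  assumes "po_eq A f g C D t t"
  shows "bd (pushout A f g C D) s n (po_class A f g C D t) = po_class A f g C D (Bd s n t)"
proof -
  have "po_class A f g C D (Bd s n u) = po_class A f g C D (Bd s n t)" if "u \<in> po_class A f g C D t" for u
    using that by (intro po_classI[OF po_eq.bd_cong[OF po_eq.sym]]) (simp add: po_class_def)
  moreover have "po_class A f g C D t \<noteq> {}" using assms by (auto simp: po_class_def)
  ultimately have "(\<Union>u\<in>po_class A f g C D t. po_class A f g C D (Bd s n u)) = po_class A f g C D (Bd s n t)"
    by (intro SUP_eq_const)
  then show ?thesis by (simp add: pushout_def)
qed

lemma pushout_composable:
  assumes "po_eq A f g C D t t" "po_eq A f g C D u u"
  shows "bd (pushout A f g C D) s n (po_class A f g C D t) = bd (pushout A f g C D) s' m (po_class A f g C D u)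
    \<longleftrightarrow> po_eq A f g C D (Bd s n t) (Bd s' m u)"
  using assms by (simp add: pushout_bd po_class_eq_iff po_eq.bd_cong)

lemma pushout_gcomp:
  assumes "po_eq A f g C D t t" "po_eq A f g C D u u" "po_eq A f g C D (Bd True n t) (Bd False n u)"
  shows "gcomp (pushout A f g C D) n (po_class A f g C D t) (po_class A f g C D u) = po_class A f g C D (Cmp n t u)"
proof -
  have "po_class A f g C D (Cmp n t' u') = po_class A f g C D (Cmp n t u)"
    if "t' \<in> po_class A f g C D t" "u' \<in> po_class A f g C D u" for t' u'
    using that assms by (intro po_classI[symmetric] po_eq.comp_cong) (simp_all add: po_class_def)
  moreover have "po_class A f g C D t \<noteq> {}" "po_class A f g C D u \<noteq> {}"
    using assms by (auto simp: po_class_def)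
  ultimately have "(\<Union>t'\<in>po_class A f g C D t. \<Union>u'\<in>po_class A f g C D u. po_class A f g C D (Cmp n t' u'))
      = po_class A f g C D (Cmp n t u)"
    by (intro SUP_eq_const)
  then show ?thesis by (simp add: pushout_def)
qed

lemma po_sub:
  assumes "omega_category C" and "omega_category D"
    and "f ` cells A \<subseteq> cells C" and "g ` cells A \<subseteq> cells D"
    and "po_eq A f g C D t u"
  defines "W \<equiv> \<lambda>t. case t of InL x \<Rightarrow> x \<in> cells C | InR y \<Rightarrow> y \<in> cells D
      | Bd s n t \<Rightarrow> po_eq A f g C D t t
      | Cmp n t u \<Rightarrow> po_eq A f g C D t t \<and> po_eq A f g C D u u \<and> po_eq A f g C D (Bd True n t) (Bd False n u)"
  shows "W t \<and> W u"
proof -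
  interpret C: omega_category C by fact
  interpret D: omega_category D by fact
  let ?E = "po_eq A f g C D"
  note sy = po_eq.sym[of A f g C D] and tr = po_eq.trans[of A f g C D]
  show ?thesis
    using assms(5)
  proof (induction rule: po_eq.induct)
    case (inl_comp x x' n)
    have "?E (Bd True n (InL x)) (Bd False n (InL x'))"
      by (rule tr[OF po_eq.inl_bd], fact, subst inl_comp(3), rule sy[OF po_eq.inl_bd], fact)
    then show ?case using inl_comp by (auto simp: W_def intro: po_eq.inl C.comp_closed)
  next
    case (inr_comp x x' n)
    have "?E (Bd True n (InR x)) (Bd False n (InR x'))"
      by (rule tr[OF po_eq.inr_bd], fact, subst inr_comp(3), rule sy[OF po_eq.inr_bd], fact)
    then show ?case using inr_comp by (auto simp: W_def intro: po_eq.inr D.comp_closed)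
  next
    case (comp_cong t t' u u' n)
    have "?E (Bd True n t') (Bd False n u')"
      using comp_cong.hyps by (meson sy tr po_eq.bd_cong)
    then show ?case using comp_cong by (auto simp: W_def intro: sy tr)
  next
    case (bd_comp_greater t u n m s)
    have "?E (Bd True n (Bd s m t)) (Bd False n (Bd s m u))"
      using bd_comp_greater.hyps by (meson sy tr po_eq.bd_bd_less)
    then show ?case using bd_comp_greater by (auto simp: W_def intro: po_eq.intros)
  next
    case (unit_left t n)
    then show ?case by (auto simp: W_def intro: po_eq.bd_bd_ge po_eq.bd_cong)
  next
    case (unit_right t n)
    then show ?case by (auto simp: W_def intro: po_eq.bd_bd_ge po_eq.bd_cong sy)
  next
    case (assoc t u v n)
    have "?E (Bd True n (Cmp n t u)) (Bd False n v)" "?E (Bd True n t) (Bd False n (Cmp n u v))"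
      using assoc.hyps by (meson sy tr po_eq.src_comp po_eq.tgt_comp)+
    then show ?case using assoc by (auto simp: W_def intro: po_eq.comp_cong)
  next
    case (interchange t t' u u' m n)
    have 1: "?E (Bd True m (Cmp n t t')) (Bd False m (Cmp n u u'))"
      using interchange.hyps by (meson sy tr po_eq.bd_comp_less)
    have "?E (Bd True n (Cmp m t u)) (Cmp m (Bd True n t) (Bd True n u))"
      using interchange.hyps by (intro po_eq.bd_comp_greater)
    moreover have "?E (Bd True m (Bd True n t)) (Bd False m (Bd True n u))"
      using interchange.hyps by (meson sy tr po_eq.bd_bd_less)
    then have "?E (Cmp m (Bd True n t) (Bd True n u)) (Cmp m (Bd False n t') (Bd False n u'))"
      using interchange.hyps by (intro po_eq.comp_cong)
    moreover have "?E (Bd False n (Cmp m t' u')) (Cmp m (Bd False n t') (Bd False n u'))"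
      using interchange.hyps by (intro po_eq.bd_comp_greater)
    ultimately have 2: "?E (Bd True n (Cmp m t u)) (Bd False n (Cmp m t' u'))"
      by (meson sy tr)
    show ?case using interchange 1 2 by (auto simp: W_def intro: po_eq.comp_cong)
  qed (use assms(3,4) in \<open>auto simp: W_def image_subset_iff intro: C.bd_closed C.comp_closed D.bd_closed D.comp_closed sy tr
      po_eq.inl po_eq.inr po_eq.bd_cong po_eq.comp_cong\<close>)
qed

lemma pushout_omega_category:
  assumes "omega_category C" and "omega_category D"
    and "f ` cells A \<subseteq> cells C" and "g ` cells A \<subseteq> cells D"
  shows "omega_category (pushout A f g C D)"
proof -
  let ?E = "po_eq A f g C D" and ?P = "pushout A f g C D"
  note sy = po_eq.sym[of A f g C D] and tr = po_eq.trans[of A f g C D]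
  note sub = po_sub[where A=A and f=f and g=g, OF assms]
  have dim: "\<exists>n. ?E (Bd False n t) t" if "?E t t" for t
    using that
  proof (induction t rule: po_term.induct)
    case (InL x)
    have x: "x \<in> cells C" using sub[OF InL] by simp
    obtain n where "src C n x = x" using omega_category.finite_dim[OF assms(1) x] ..
    then have "?E (Bd False n (InL x)) (InL x)" using po_eq.inl_bd[OF x, of A f g D False n] by simp
    then show ?case by (rule exI)
  next
    case (InR x)
    have x: "x \<in> cells D" using sub[OF InR] by simp
    obtain n where "src D n x = x" using omega_category.finite_dim[OF assms(2) x] ..
    then have "?E (Bd False n (InR x)) (InR x)" using po_eq.inr_bd[OF x, of A f g C False n] by simp
    then show ?case by (rule exI)
  next
    case (Bd s n t)
    have "?E t t" using sub[OF Bd.prems] by simp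
    from po_eq.bd_bd_ge[OF this order_refl] show ?case by (rule exI)
  next
    case (Cmp n t u)
    have *: "?E t t" "?E u u" "?E (Bd True n t) (Bd False n u)" using sub[OF Cmp.prems] by simp_all
    obtain k l where kl: "?E (Bd False k t) t" "?E (Bd False l u) u"
      using Cmp.IH(1)[OF *(1)] Cmp.IH(2)[OF *(2)] by (elim exE) (rule that)
    define m where "m = Suc (max n (max k l))"
    have m: "n < m" "k \<le> m" "l \<le> m" by (auto simp: m_def)
    have up: "?E (Bd False m v) v" if "?E (Bd False j v) v" "j \<le> m" "?E v v" for j v
      by (rule tr[OF po_eq.bd_cong[OF sy[OF that(1)]] tr[OF po_eq.bd_bd_ge[OF that(3,2)] that(1)]])
    have "?E (Bd False m (Cmp n t u)) (Cmp n (Bd False m t) (Bd False m u))"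
      by (rule po_eq.bd_comp_greater[OF * m(1)])
    moreover have "?E (Cmp n t u) (Cmp n (Bd False m t) (Bd False m u))"
      by (rule po_eq.comp_cong[OF sy[OF up[OF kl(1) m(2) *(1)]] sy[OF up[OF kl(2) m(3) *(2)]] *(3)])
    ultimately have "?E (Bd False m (Cmp n t u)) (Cmp n t u)" by (rule tr[OF _ sy])
    then show ?case by (rule exI)
  qed
  let ?cl = "po_class A f g C D"
  have cellE: thesis if "x \<in> cells ?P" "\<And>t. ?E t t \<Longrightarrow> x = ?cl t \<Longrightarrow> thesis" for x thesis
    using that(1) unfolding pushout_cells by (elim exE conjE) (rule that(2))
  have cellI: "?cl t \<in> cells ?P" if "?E t t" for t
    unfolding pushout_cells by (rule exI[of _ t]) (simp add: that)
  note bd = pushout_bd[of A f g C D] and cmp = pushout_gcomp[of A f g C D]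
    and composable = pushout_composable[of A f g C D, THEN iffD1]
  note bdw = po_eq.bd_cong[of A f g C D] and cmpw = po_eq.comp_cong[of A f g C D]
    and cl = po_classI[of A f g C D]
  show ?thesis
  proof (unfold_locales, goal_cases)
    case (1 x s n)
    obtain t where t: "?E t t" and x: "x = ?cl t" using cellE[OF 1] .
    show ?case unfolding x bd[OF t] by (rule cellI[OF bdw[OF t]])
  next
    case (2 x y n)
    obtain t where t: "?E t t" and x: "x = ?cl t" using cellE[OF 2(1)] .
    obtain u where u: "?E u u" and y: "y = ?cl u" using cellE[OF 2(2)] .
    note tu = composable[OF t u 2(3)[unfolded x y]]
    show ?case unfolding x y cmp[OF t u tu] by (rule cellI[OF cmpw[OF t u tu]])
  next
    case (3 x m n s s')
    obtain t where t: "?E t t" and x: "x = ?cl t" using cellE[OF 3(1)] .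
    show ?case unfolding x bd[OF t] bd[OF bdw[OF t]]
      by (rule cl[OF po_eq.bd_bd_less[OF t 3(2)]])
  next
    case (4 x n m s s')
    obtain t where t: "?E t t" and x: "x = ?cl t" using cellE[OF 4(1)] .
    show ?case unfolding x bd[OF t] bd[OF bdw[OF t]]
      by (rule cl[OF po_eq.bd_bd_ge[OF t 4(2)]])
  next
    case (5 x y n)
    obtain t where t: "?E t t" and x: "x = ?cl t" using cellE[OF 5(1)] .
    obtain u where u: "?E u u" and y: "y = ?cl u" using cellE[OF 5(2)] .
    note tu = composable[OF t u 5(3)[unfolded x y]]
    show ?case unfolding x y cmp[OF t u tu] bd[OF t] bd[OF cmpw[OF t u tu]]
      by (rule cl[OF po_eq.src_comp[OF t u tu]])
  next
    case (6 x y n)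
    obtain t where t: "?E t t" and x: "x = ?cl t" using cellE[OF 6(1)] .
    obtain u where u: "?E u u" and y: "y = ?cl u" using cellE[OF 6(2)] .
    note tu = composable[OF t u 6(3)[unfolded x y]]
    show ?case unfolding x y cmp[OF t u tu] bd[OF u] bd[OF cmpw[OF t u tu]]
      by (rule cl[OF po_eq.tgt_comp[OF t u tu]])
  next
    case (7 x y n m s)
    obtain t where t: "?E t t" and x: "x = ?cl t" using cellE[OF 7(1)] .
    obtain u where u: "?E u u" and y: "y = ?cl u" using cellE[OF 7(2)] .
    note tu = composable[OF t u 7(3)[unfolded x y]]
    show ?case unfolding x y cmp[OF t u tu] bd[OF t] bd[OF cmpw[OF t u tu]]
      by (rule cl[OF po_eq.bd_comp_less[OF t u tu 7(4)]])
  next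
    case (8 x y n m s)
    obtain t where t: "?E t t" and x: "x = ?cl t" using cellE[OF 8(1)] .
    obtain u where u: "?E u u" and y: "y = ?cl u" using cellE[OF 8(2)] .
    note tu = composable[OF t u 8(3)[unfolded x y]]
    note E = po_eq.bd_comp_greater[OF t u tu 8(4), of s]
    have bb: "?E (Bd True n (Bd s m t)) (Bd False n (Bd s m u))" using sub[OF E] by simp
    show ?case
      unfolding x y cmp[OF t u tu] bd[OF t] bd[OF u] bd[OF cmpw[OF t u tu]] cmp[OF bdw[OF t] bdw[OF u] bb]
      by (rule cl[OF E])
  next
    case (9 x n)
    obtain t where t: "?E t t" and x: "x = ?cl t" using cellE[OF 9] .
    have b: "?E (Bd True n (Bd False n t)) (Bd False n t)" by (rule po_eq.bd_bd_ge[OF t order_refl])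
    show ?case unfolding x bd[OF t] cmp[OF bdw[OF t] t b] by (rule cl[OF po_eq.unit_left[OF t]])
  next
    case (10 x n)
    obtain t where t: "?E t t" and x: "x = ?cl t" using cellE[OF 10] .
    have b: "?E (Bd True n t) (Bd False n (Bd True n t))" by (rule sy[OF po_eq.bd_bd_ge[OF t order_refl]])
    show ?case unfolding x bd[OF t] cmp[OF t bdw[OF t] b] by (rule cl[OF po_eq.unit_right[OF t]])
  next
    case (11 x y z n)
    obtain t where t: "?E t t" and x: "x = ?cl t" using cellE[OF 11(1)] .
    obtain u where u: "?E u u" and y: "y = ?cl u" using cellE[OF 11(2)] .
    obtain v where v: "?E v v" and z: "z = ?cl v" using cellE[OF 11(3)] .
    note tu = composable[OF t u 11(4)[unfolded x y]] and uv = composable[OF u v 11(5)[unfolded y z]]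
    note E = po_eq.assoc[OF t u v tu uv]
    have c: "?E (Bd True n (Cmp n t u)) (Bd False n v)" "?E (Bd True n t) (Bd False n (Cmp n u v))"
      using sub[OF E] by simp_all
    show ?case
      unfolding x y z cmp[OF t u tu] cmp[OF u v uv] cmp[OF cmpw[OF t u tu] v c(1)] cmp[OF t cmpw[OF u v uv] c(2)]
      by (rule cl[OF E])
  next
    case (12 x x' y y' m n)
    obtain t where t: "?E t t" and x: "x = ?cl t" using cellE[OF 12(1)] .
    obtain t' where t': "?E t' t'" and x': "x' = ?cl t'" using cellE[OF 12(2)] .
    obtain u where u: "?E u u" and y: "y = ?cl u" using cellE[OF 12(3)] .
    obtain u' where u': "?E u' u'" and y': "y' = ?cl u'" using cellE[OF 12(4)] .
    note tt = composable[OF t t' 12(6)[unfolded x x']] and uu = composable[OF u u' 12(7)[unfolded y y']]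
    note tu = composable[OF t u 12(8)[unfolded x y]] and tu' = composable[OF t' u' 12(9)[unfolded x' y']]
    note E = po_eq.interchange[OF t t' u u' 12(5) tt uu tu tu']
    have c: "?E (Bd True m (Cmp n t t')) (Bd False m (Cmp n u u'))"
        "?E (Bd True n (Cmp m t u)) (Bd False n (Cmp m t' u'))"
      using sub[OF E] by simp_all
    show ?case
      unfolding x x' y y' cmp[OF t t' tt] cmp[OF u u' uu] cmp[OF t u tu] cmp[OF t' u' tu']
        cmp[OF cmpw[OF t t' tt] cmpw[OF u u' uu] c(1)] cmp[OF cmpw[OF t u tu] cmpw[OF t' u' tu'] c(2)]
      by (rule cl[OF E])
  next
    case (13 x)
    obtain t where t: "?E t t" and x: "x = ?cl t" using cellE[OF 13] .
    obtain n where "?E (Bd False n t) t" using dim[OF t] ..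
    then have "src ?P n x = x" unfolding x bd[OF t] by (rule cl)
    then show ?case by (rule exI)
  qed
qed

lemma pushout_square:
  shows "strict_functor (\<lambda>x. po_class A f g C D (InL x)) C (pushout A f g C D)"
    and "strict_functor (\<lambda>y. po_class A f g C D (InR y)) D (pushout A f g C D)"
    and "c \<in> cells A \<Longrightarrow> po_class A f g C D (InL (f c)) = po_class A f g C D (InR (g c))"
proof -
  note sy = po_eq.sym[of A f g C D] and tr = po_eq.trans[of A f g C D]
  let ?P = "pushout A f g C D" and ?cl = "po_class A f g C D"
  show "strict_functor (\<lambda>x. ?cl (InL x)) C ?P"
    unfolding strict_functor_def
  proof (intro conjI ballI allI impI)
    fix x s n assume x: "x \<in> cells C"
    then have E: "po_eq A f g C D (InL x) (InL x)" by (rule po_eq.inl)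
    then show "?cl (InL x) \<in> cells ?P" unfolding pushout_cells by blast
    show "?cl (InL (bd C s n x)) = bd ?P s n (?cl (InL x))"
      unfolding pushout_bd[OF E] by (rule po_classI[OF po_eq.inl_bd[OF x], symmetric])
    fix y assume y: "y \<in> cells C" and c: "tgt C n x = src C n y"
    have E': "po_eq A f g C D (InL y) (InL y)" using y by (rule po_eq.inl)
    have "po_eq A f g C D (Bd True n (InL x)) (Bd False n (InL y))"
      by (rule tr[OF po_eq.inl_bd[OF x]], subst c, rule sy[OF po_eq.inl_bd[OF y]])
    moreover have "?cl (Cmp n (InL x) (InL y)) = ?cl (InL (gcomp C n x y))"
      by (rule po_classI[OF po_eq.inl_comp[OF x y c]])
    ultimately show "?cl (InL (gcomp C n x y)) = gcomp ?P n (?cl (InL x)) (?cl (InL y))"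
      using E E' by (simp add: pushout_gcomp)
  qed
  show "strict_functor (\<lambda>x. ?cl (InR x)) D ?P"
    unfolding strict_functor_def
  proof (intro conjI ballI allI impI)
    fix x s n assume x: "x \<in> cells D"
    then have E: "po_eq A f g C D (InR x) (InR x)" by (rule po_eq.inr)
    then show "?cl (InR x) \<in> cells ?P" unfolding pushout_cells by blast
    show "?cl (InR (bd D s n x)) = bd ?P s n (?cl (InR x))"
      unfolding pushout_bd[OF E] by (rule po_classI[OF po_eq.inr_bd[OF x], symmetric])
    fix y assume y: "y \<in> cells D" and c: "tgt D n x = src D n y"
    have E': "po_eq A f g C D (InR y) (InR y)" using y by (rule po_eq.inr)
    have "po_eq A f g C D (Bd True n (InR x)) (Bd False n (InR y))"
      by (rule tr[OF po_eq.inr_bd[OF x]], subst c, rule sy[OF po_eq.inr_bd[OF y]])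
    moreover have "?cl (Cmp n (InR x) (InR y)) = ?cl (InR (gcomp D n x y))"
      by (rule po_classI[OF po_eq.inr_comp[OF x y c]])
    ultimately show "?cl (InR (gcomp D n x y)) = gcomp ?P n (?cl (InR x)) (?cl (InR y))"
      using E E' by (simp add: pushout_gcomp)
  qed
  show "?cl (InL (f c)) = ?cl (InR (g c))" if "c \<in> cells A"
    by (rule po_classI[OF po_eq.glue[OF that]])
qed

primrec po_eval :: "('z, 'm) omega_scheme \<Rightarrow> ('a \<Rightarrow> 'z) \<Rightarrow> ('b \<Rightarrow> 'z) \<Rightarrow> ('a, 'b) po_term \<Rightarrow> 'z" where
  "po_eval Z h k (InL x) = h x"
| "po_eval Z h k (InR y) = k y"
| "po_eval Z h k (Bd s n t) = bd Z s n (po_eval Z h k t)"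
| "po_eval Z h k (Cmp n t u) = gcomp Z n (po_eval Z h k t) (po_eval Z h k u)"

lemma po_eval_sound:
  assumes "omega_category Z" and "strict_functor h C Z" and "strict_functor k D Z"
    and "\<And>c. c \<in> cells A \<Longrightarrow> h (f c) = k (g c)"
    and "f ` cells A \<subseteq> cells C"
    and "po_eq A f g C D t u"
  shows "po_eval Z h k t \<in> cells Z \<and> po_eval Z h k t = po_eval Z h k u"
proof -
  interpret Z: omega_category Z by fact
  have h: "h x \<in> cells Z" "h (bd C s n x) = bd Z s n (h x)" if "x \<in> cells C" for x s n
    using assms(2) that by (auto simp: strict_functor_def)
  have hc: "h (gcomp C n x y) = gcomp Z n (h x) (h y)" "tgt Z n (h x) = src Z n (h y)"
    if "x \<in> cells C" "y \<in> cells C" "tgt C n x = src C n y" for x y n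
    using assms(2) that unfolding strict_functor_def by metis+
  have k: "k x \<in> cells Z" "k (bd D s n x) = bd Z s n (k x)" if "x \<in> cells D" for x s n
    using assms(3) that by (auto simp: strict_functor_def)
  have kc: "k (gcomp D n x y) = gcomp Z n (k x) (k y)" "tgt Z n (k x) = src Z n (k y)"
    if "x \<in> cells D" "y \<in> cells D" "tgt D n x = src D n y" for x y n
    using assms(3) that unfolding strict_functor_def by metis+
  show ?thesis
    using assms(6)
  proof (induction rule: po_eq.induct)
    case (inl_comp x x' n)
    then show ?case using hc[of x x' n] by (simp add: Z.comp_closed h(1))
  next
    case (inr_comp x x' n)
    then show ?case using kc[of x x' n] by (simp add: Z.comp_closed k(1))
  next
    case (glue c)
    then show ?case using assms(4)[of c] assms(5) h(1)[of "f c"] by auto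
  next
    case (interchange t t' u u' m n)
    let ?v = "po_eval Z h k"
    have "tgt Z m (gcomp Z n (?v t) (?v t')) = src Z m (gcomp Z n (?v u) (?v u'))"
      using interchange by (simp add: Z.bd_comp_less)
    then show ?case using interchange by (auto intro: Z.comp_closed Z.interchange)
  qed (auto simp: h k Z.bd_bd_less Z.bd_bd_ge Z.src_comp Z.tgt_comp Z.bd_comp_less
      Z.bd_comp_greater Z.unit_left Z.unit_right Z.assoc intro: Z.bd_closed Z.comp_closed)
qed

lemma pushout_universal:
  assumes "omega_category Z"
    and "strict_functor h C Z" and "strict_functor k D Z"
    and "\<And>c. c \<in> cells A \<Longrightarrow> h (f c) = k (g c)"
    and "f ` cells A \<subseteq> cells C"
  shows "\<exists>\<phi>. strict_functor \<phi> (pushout A f g C D) Z \<and>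
             (\<forall>x\<in>cells C. \<phi> (po_class A f g C D (InL x)) = h x) \<and>
             (\<forall>y\<in>cells D. \<phi> (po_class A f g C D (InR y)) = k y)"
proof -
  let ?E = "po_eq A f g C D" and ?P = "pushout A f g C D" and ?cl = "po_class A f g C D"
  have ev: "po_eval Z h k t \<in> cells Z \<and> po_eval Z h k t = po_eval Z h k u" if "?E t u" for t u
    by (rule po_eval_sound[OF assms(1-3), of A f g]) (use assms(4,5) that in auto)
  define \<phi> where "\<phi> P = po_eval Z h k (SOME t. t \<in> P)" for P
  have \<phi>: "\<phi> (?cl t) = po_eval Z h k t" if "?E t t" for t
  proof -
    have "(SOME u. u \<in> ?cl t) \<in> ?cl t"
      by (rule someI[of _ t]) (simp add: po_class_def that)
    then have "?E t (SOME u. u \<in> ?cl t)" by (simp add: po_class_def)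
    from ev[OF this] show ?thesis by (simp add: \<phi>_def)
  qed
  have "strict_functor \<phi> ?P Z"
    unfolding strict_functor_def
  proof (intro conjI ballI allI impI)
    fix P assume "P \<in> cells ?P"
    then obtain t where t: "?E t t" and P: "P = ?cl t" unfolding pushout_cells by blast
    show "\<phi> P \<in> cells Z" unfolding P \<phi>[OF t] using ev[OF t] by blast
    show "\<phi> (bd ?P s n P) = bd Z s n (\<phi> P)" for s n
      unfolding P pushout_bd[OF t] \<phi>[OF t] \<phi>[OF po_eq.bd_cong[OF t]] by simp
    fix Q n assume "Q \<in> cells ?P" and c: "tgt ?P n P = src ?P n Q"
    then obtain u where u: "?E u u" and Q: "Q = ?cl u" unfolding pushout_cells by blast
    have tu: "?E (Bd True n t) (Bd False n u)"
      using c unfolding P Q pushout_composable[OF t u] .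
    show "\<phi> (gcomp ?P n P Q) = gcomp Z n (\<phi> P) (\<phi> Q)"
      unfolding P Q pushout_gcomp[OF t u tu] \<phi>[OF t] \<phi>[OF u] \<phi>[OF po_eq.comp_cong[OF t u tu]] by simp
  qed
  moreover have "\<forall>x\<in>cells C. \<phi> (?cl (InL x)) = h x" "\<forall>y\<in>cells D. \<phi> (?cl (InR y)) = k y"
    using \<phi> by (simp_all add: po_eq.inl po_eq.inr)
  ultimately show ?thesis by blast
qed

lemma pushout_unique:
  assumes "omega_category C" and "omega_category D"
    and "f ` cells A \<subseteq> cells C" and "g ` cells A \<subseteq> cells D"
    and "strict_functor \<phi> (pushout A f g C D) Z" and "strict_functor \<psi> (pushout A f g C D) Z"
    and "\<And>x. x \<in> cells C \<Longrightarrow> \<phi> (po_class A f g C D (InL x)) = \<psi> (po_class A f g C D (InL x))"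
    and "\<And>y. y \<in> cells D \<Longrightarrow> \<phi> (po_class A f g C D (InR y)) = \<psi> (po_class A f g C D (InR y))"
    and "P \<in> cells (pushout A f g C D)"
  shows "\<phi> P = \<psi> P"
proof -
  let ?E = "po_eq A f g C D" and ?P = "pushout A f g C D" and ?cl = "po_class A f g C D"
  note sub = po_sub[where A=A and f=f and g=g, OF assms(1-4)]
  note fn = assms(5,6)[unfolded strict_functor_def]
  have "\<phi> (?cl t) = \<psi> (?cl t)" if "?E t t" for t
    using that
  proof (induction t rule: po_term.induct)
    case (InL x) then show ?case using sub assms(7) by fastforce
  next
    case (InR y) then show ?case using sub assms(8) by fastforce
  next
    case (Bd s n t)
    then have t: "?E t t" using sub by fastforce
    then have "?cl t \<in> cells ?P" by (auto simp: pushout_cells)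
    then show ?case using Bd.IH t fn by (metis pushout_bd)
  next
    case (Cmp n t u)
    then have t: "?E t t" "?E u u" "?E (Bd True n t) (Bd False n u)" using sub by fastforce+
    then have "?cl t \<in> cells ?P" "?cl u \<in> cells ?P" "tgt ?P n (?cl t) = src ?P n (?cl u)"
      by (auto simp: pushout_cells pushout_composable)
    moreover have "?cl (Cmp n t u) = gcomp ?P n (?cl t) (?cl u)" using t by (simp add: pushout_gcomp)
    ultimately show ?case using Cmp.IH t fn by metis
  qed
  then show ?thesis using assms(9) by (auto simp: pushout_cells)
qed

definition wedge :: "'a bip_omega \<Rightarrow> 'b bip_omega \<Rightarrow> ('a, 'b) po_term set bip_omega" where
  "wedge C D =
     (let f = (\<lambda>_. pt1 C); g = (\<lambda>_. pt0 D) in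
      bipoint (pushout terminal_omega f g C D)
        (po_class terminal_omega f g C D (InL (pt0 C)))
        (po_class terminal_omega f g C D (InR (pt1 D))))"

lemma wedge_bipointed:
  assumes "bipointed C" and "bipointed D"
  shows "bipointed (wedge C D)"
proof -
  let ?P = "pushout terminal_omega (\<lambda>_. pt1 C) (\<lambda>_. pt0 D) C D"
  let ?cl = "po_class terminal_omega (\<lambda>_. pt1 C) (\<lambda>_. pt0 D) C D"
  have C: "omega_category C" "pt0 C \<in> objects C" "pt1 C \<in> objects C"
    and D: "omega_category D" "pt0 D \<in> objects D" "pt1 D \<in> objects D"
    using assms by (auto simp: bipointed_def)
  have "omega_category ?P"
    using C D by (intro pushout_omega_category) (auto simp: objects_def)
  moreover have "?cl (InL (pt0 C)) \<in> objects ?P"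
    using pushout_square(1)[of "terminal_omega" "\<lambda>_. pt1 C" "\<lambda>_. pt0 D" C D] C(2)
    unfolding strict_functor_def objects_def by (smt (verit) mem_Collect_eq)
  moreover have "?cl (InR (pt1 D)) \<in> objects ?P"
    using pushout_square(2)[of "terminal_omega" "\<lambda>_. pt1 C" "\<lambda>_. pt0 D" C D] D(3)
    unfolding strict_functor_def objects_def by (smt (verit) mem_Collect_eq)
  ultimately show ?thesis by (simp add: wedge_def Let_def bipointed_def objects_def)
qed


section \<open>Augmented directed complexes and the \<open>\<omega>\<close>-categories they generate\<close>

text \<open>
  An augmented directed complex with a basis: the group of \<open>n\<close>-chains is free on the basis
  elements of degree \<open>n\<close>, and the submonoid of positive chains consists of their
  non-negative combinations.  The differential and the augmentation are given on basis elements
  (the value of \<open>aug\<close> matters in degree \<open>0\<close> only).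
\<close>

record 'b adc =
  basis :: "'b set"
  deg :: "'b \<Rightarrow> nat"
  diff :: "'b \<Rightarrow> ('b \<Rightarrow>\<^sub>0 int)"
  aug :: "'b \<Rightarrow> int"

definition pos_chain :: "('b, 'm) adc_scheme \<Rightarrow> nat \<Rightarrow> ('b \<Rightarrow>\<^sub>0 int) \<Rightarrow> bool" where
  "pos_chain K n c \<longleftrightarrow> Poly_Mapping.keys c \<subseteq> {b \<in> basis K. deg K b = n} \<and> (\<forall>b. 0 \<le> Poly_Mapping.lookup c b)"

definition chain_aug :: "('b, 'm) adc_scheme \<Rightarrow> ('b \<Rightarrow>\<^sub>0 int) \<Rightarrow> int" where
  "chain_aug K c = (\<Sum>b\<in>Poly_Mapping.keys c. Poly_Mapping.lookup c b * aug K b)"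

text \<open>
  Steiner's functor \<open>\<nu>\<close>.  A cell is a double sequence of positive chains; \<open>x False i\<close> and
  \<open>x True i\<close> are the negative and the positive component in degree \<open>i\<close>.
\<close>

definition nu :: "('b, 'm) adc_scheme \<Rightarrow> (bool \<Rightarrow> nat \<Rightarrow> ('b \<Rightarrow>\<^sub>0 int)) omega" where
  "nu K = \<lparr>
     cells = {x. (\<forall>s i. pos_chain K i (x s i)) \<and>
                 (\<exists>N. \<forall>s. \<forall>i>N. x s i = 0) \<and>
                 (\<forall>s i. frag_extend (diff K) (x s (Suc i)) = x True i - x False i) \<and>
                 (\<forall>s. chain_aug K (x s 0) = 1)},
     bd = (\<lambda>s n x. \<lambda>s' i. if i < n then x s' i else if i = n then x s n else 0),
     gcomp = (\<lambda>n x y. \<lambda>s i. x s i - (if i < n then x s i else if i = n then x True n else 0) + y s i)\<rparr>"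

lemma pos_chain_0 [simp]: "pos_chain K n 0"
  by (simp add: pos_chain_def)

lemma pos_chain_add: "pos_chain K n a \<Longrightarrow> pos_chain K n b \<Longrightarrow> pos_chain K n (a + b)"
  using Poly_Mapping.keys_add[of a b] unfolding pos_chain_def by (auto simp: lookup_add)

lemma nu_bd: "bd (nu K) s n x = (\<lambda>s' i. if i < n then x s' i else if i = n then x s n else 0)"
  by (simp add: nu_def)

lemma nu_composable:
  "tgt (nu K) n x = src (nu K) n y \<longleftrightarrow> (\<forall>s. \<forall>i<n. x s i = y s i) \<and> x True n = y False n"
  (is "?L \<longleftrightarrow> ?R")
proof
  assume ?L
  then have *: "tgt (nu K) n x s i = src (nu K) n y s i" for s i by simp
  show ?R using *[of _ n] *[of _ i for i] by (auto simp: nu_bd split: if_splits) metis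
next
  assume ?R then show ?L by (auto simp: nu_bd fun_eq_iff)
qed

lemma nu_gcomp:
  assumes "tgt (nu K) n x = src (nu K) n y"
  shows "gcomp (nu K) n x y =
    (\<lambda>s i. if i < n then x s i else if i = n then (if s then y True n else x False n) else x s i + y s i)"
  using assms unfolding nu_composable by (auto simp: nu_def fun_eq_iff)

lemma nu_cells: "x \<in> cells (nu K) \<longleftrightarrow>
    (\<forall>s i. pos_chain K i (x s i)) \<and> (\<exists>N. \<forall>s. \<forall>i>N. x s i = 0) \<and>
    (\<forall>s i. frag_extend (diff K) (x s (Suc i)) = x True i - x False i) \<and> (\<forall>s. chain_aug K (x s 0) = 1)"
  by (simp add: nu_def)

lemma nu_omega_category: "omega_category (nu K)"
proof (unfold_locales, goal_cases)
  case (1 x s n)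
  from 1 obtain N where "\<forall>s. \<forall>i>N. x s i = 0" unfolding nu_cells by blast
  then have "\<exists>N. \<forall>s'. \<forall>i>N. bd (nu K) s n x s' i = 0" by (intro exI[of _ N]) (auto simp: nu_bd)
  moreover have "frag_extend (diff K) (x s (Suc i)) = x True i - x False i" for s i
    using 1 unfolding nu_cells by blast
  then have "frag_extend (diff K) (bd (nu K) s n x s' (Suc i)) = bd (nu K) s n x True i - bd (nu K) s n x False i" for s' i
    using linorder_less_linear[of "Suc i" n] by (auto simp: nu_bd)
  ultimately show ?case using 1 unfolding nu_cells by (auto simp: nu_bd)
next
  case (2 x y n)
  let ?z = "gcomp (nu K) n x y"
  from 2 obtain N M where "\<forall>s. \<forall>i>N. x s i = 0" "\<forall>s. \<forall>i>M. y s i = 0" unfolding nu_cells by blast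
  then have "\<forall>s. \<forall>i>max N M. ?z s i = 0" by (auto simp: nu_gcomp[OF 2(3)])
  then have fin: "\<exists>N. \<forall>s. \<forall>i>N. ?z s i = 0" by blast
  have c: "x s i = y s i" "x True n = y False n" if "i < n" for s i
    using 2(3) that unfolding nu_composable by auto
  have c': "x True n = y False n" using 2(3) unfolding nu_composable by auto
  have x: "pos_chain K i (x s i)" "frag_extend (diff K) (x s (Suc i)) = x True i - x False i"
    "chain_aug K (x s 0) = 1" for s i using 2(1) unfolding nu_cells by auto
  have y: "pos_chain K i (y s i)" "frag_extend (diff K) (y s (Suc i)) = y True i - y False i"
    "chain_aug K (y s 0) = 1" for s i using 2(2) unfolding nu_cells by auto
  have "pos_chain K i (?z s i)" for s i
    using x(1) y(1) by (auto simp: nu_gcomp[OF 2(3)] pos_chain_add)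
  moreover have "frag_extend (diff K) (?z s (Suc i)) = ?z True i - ?z False i" for s i
    using linorder_less_linear[of "Suc i" n]
    by (auto simp: nu_gcomp[OF 2(3)] x(2) y(2) frag_extend_add c' c)
  moreover have "chain_aug K (?z s 0) = 1" for s
    using x(3) y(3) by (auto simp: nu_gcomp[OF 2(3)])
  ultimately show ?case unfolding nu_cells using fin by blast
next
  case (3 x m n s s') then show ?case by (auto simp: nu_bd fun_eq_iff)
next
  case (4 x n m s s') then show ?case by (auto simp: nu_bd fun_eq_iff)
next
  case (5 x y n) then show ?case by (auto simp: nu_gcomp) (auto simp: nu_bd fun_eq_iff)
next
  case (6 x y n)
  then have "x s i = y s i" if "i < n" for s i using that unfolding nu_composable by auto
  with 6 show ?case by (auto simp: nu_gcomp) (auto simp: nu_bd fun_eq_iff)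
next
  case (7 x y n m s) then show ?case by (auto simp: nu_gcomp) (auto simp: nu_bd fun_eq_iff)
next
  case (8 x y n m s)
  have "tgt (nu K) n (bd (nu K) s m x) = src (nu K) n (bd (nu K) s m y)"
    using 8(3,4) unfolding nu_composable by (auto simp: nu_bd)
  from nu_gcomp[OF this] show ?case
    unfolding nu_gcomp[OF 8(3)] using 8(4) by (auto simp: nu_bd fun_eq_iff)
next
  case (9 x n)
  have c: "tgt (nu K) n (src (nu K) n x) = src (nu K) n x"
    unfolding nu_composable by (auto simp: nu_bd)
  show ?case unfolding nu_gcomp[OF c] by (auto simp: nu_bd fun_eq_iff)
next
  case (10 x n)
  have c: "tgt (nu K) n x = src (nu K) n (tgt (nu K) n x)"
    unfolding nu_composable by (auto simp: nu_bd)
  show ?case unfolding nu_gcomp[OF c] by (auto simp: nu_bd fun_eq_iff)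
next
  case (11 x y z n)
  note e = nu_gcomp[OF 11(4)] nu_gcomp[OF 11(5)]
  have c1: "tgt (nu K) n (gcomp (nu K) n x y) = src (nu K) n z"
    using 11(4,5) unfolding e nu_composable by auto
  have c2: "tgt (nu K) n x = src (nu K) n (gcomp (nu K) n y z)"
    using 11(4,5) unfolding e nu_composable by auto
  show ?case unfolding nu_gcomp[OF c1] nu_gcomp[OF c2] unfolding e by (auto simp: fun_eq_iff)
next
  case (12 x x' y y' m n)
  note c = 12(6-9)[unfolded nu_composable]
  note e = nu_gcomp[OF 12(6)] nu_gcomp[OF 12(7)] nu_gcomp[OF 12(8)] nu_gcomp[OF 12(9)]
  have c1: "tgt (nu K) m (gcomp (nu K) n x x') = src (nu K) m (gcomp (nu K) n y y')"
    using c 12(5) unfolding e nu_composable by auto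
  have c2: "tgt (nu K) n (gcomp (nu K) m x y) = src (nu K) n (gcomp (nu K) m x' y')"
    using c 12(5) unfolding e nu_composable by auto
  show ?case unfolding nu_gcomp[OF c1] nu_gcomp[OF c2] unfolding e
    using c 12(5) by (auto simp: fun_eq_iff)
next
  case (13 x)
  then obtain N where "\<forall>s. \<forall>i>N. x s i = 0" unfolding nu_cells by blast
  then have "src (nu K) (Suc N) x = x" by (auto simp: nu_bd fun_eq_iff)
  then show ?case by blast
qed

definition nu_vertex :: "'b \<Rightarrow> bool \<Rightarrow> nat \<Rightarrow> ('b \<Rightarrow>\<^sub>0 int)" where
  "nu_vertex b = (\<lambda>_ i. if i = 0 then frag_of b else 0)"

lemma nu_vertex_object:
  assumes "b \<in> basis K" and "deg K b = 0" and "aug K b = 1"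
  shows "nu_vertex b \<in> objects (nu K)"
  using assms by (auto simp: objects_def nu_cells nu_bd nu_vertex_def pos_chain_def chain_aug_def fun_eq_iff)

definition tensor_chain :: "('a \<Rightarrow>\<^sub>0 int) \<Rightarrow> ('b \<Rightarrow>\<^sub>0 int) \<Rightarrow> ('a \<times> 'b \<Rightarrow>\<^sub>0 int)" where
  "tensor_chain c e = frag_extend (\<lambda>a. frag_extend (\<lambda>b. frag_of (a, b)) e) c"

definition tensor_adc :: "'a adc \<Rightarrow> 'b adc \<Rightarrow> ('a \<times> 'b) adc" where
  "tensor_adc K L = \<lparr>
     basis = basis K \<times> basis L,
     deg = (\<lambda>(a, b). deg K a + deg L b),
     diff = (\<lambda>(a, b). tensor_chain (diff K a) (frag_of b)
                    + frag_cmul ((-1) ^ deg K a) (tensor_chain (frag_of a) (diff L b))),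
     aug = (\<lambda>(a, b). aug K a * aug L b)\<rparr>"

text \<open>Renaming of basis elements along a bijection \<open>p\<close> with inverse \<open>q\<close>.\<close>

definition rename_adc :: "('a \<Rightarrow> 'b) \<Rightarrow> ('b \<Rightarrow> 'a) \<Rightarrow> 'a adc \<Rightarrow> 'b adc" where
  "rename_adc p q K = \<lparr>
     basis = p ` basis K,
     deg = (\<lambda>b. deg K (q b)),
     diff = (\<lambda>b. frag_extend (\<lambda>a. frag_of (p a)) (diff K (q b))),
     aug = (\<lambda>b. aug K (q b))\<rparr>"


section \<open>Cubes\<close>

datatype interval = V0 | V1 | Edge

definition interval_adc :: "interval adc" where
  "interval_adc = \<lparr>
     basis = UNIV,
     deg = (\<lambda>b. if b = Edge then 1 else 0),
     diff = (\<lambda>b. if b = Edge then frag_of V1 - frag_of V0 else 0),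
     aug = (\<lambda>b. if b = Edge then 0 else 1)\<rparr>"

text \<open>The cells of \<open>\<nu>\<close> of the interval are two objects and one arrow.\<close>

lemma nu_interval_cells:
  "cells (nu interval_adc) =
     {nu_vertex V0, nu_vertex V1,
      (\<lambda>s i. if i = 0 then frag_of (if s then V1 else V0) else if i = 1 then frag_of Edge else 0)}"
  (is "_ = {_, _, ?e}")
proof (intro equalityI subsetI)
  fix x assume x: "x \<in> cells (nu interval_adc)"
  have UNIV_interval: "(UNIV :: interval set) = {V0, V1, Edge}"
    using interval.exhaust by blast
  have frag: "c = d" if "Poly_Mapping.lookup c V0 = Poly_Mapping.lookup d V0"
      "Poly_Mapping.lookup c V1 = Poly_Mapping.lookup d V1"
      "Poly_Mapping.lookup c Edge = Poly_Mapping.lookup d Edge" for c d :: "interval \<Rightarrow>\<^sub>0 int"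
    using that by (intro poly_mapping_eqI) (metis interval.exhaust)
  have sum_keys: "(\<Sum>b\<in>Poly_Mapping.keys c. Poly_Mapping.lookup c b * w b) = (\<Sum>b\<in>UNIV. Poly_Mapping.lookup c b * w b)"
    for c :: "interval \<Rightarrow>\<^sub>0 int" and w :: "interval \<Rightarrow> int"
    by (rule sum.mono_neutral_left) (simp_all add: UNIV_interval[symmetric] in_keys_iff, simp add: UNIV_interval)
  have lookup_ext: "Poly_Mapping.lookup (frag_extend f c) a = (\<Sum>b\<in>UNIV. Poly_Mapping.lookup c b * Poly_Mapping.lookup (f b) a)"
    for f :: "interval \<Rightarrow> interval \<Rightarrow>\<^sub>0 int" and c a
    by (simp add: frag_extend_def lookup_sum sum_keys)
  have pos: "pos_chain interval_adc i (x s i)" and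
    d: "frag_extend (diff interval_adc) (x s (Suc i)) = x True i - x False i" and
    aug: "chain_aug interval_adc (x s 0) = 1" for s i
    using x unfolding nu_cells by blast+
  have nonneg: "0 \<le> Poly_Mapping.lookup (x s i) b" for s i b
    using pos unfolding pos_chain_def by blast
  have zero: "Poly_Mapping.lookup (x s i) b = 0" if "deg interval_adc b \<noteq> i" for s i b
    using pos[of i s] that unfolding pos_chain_def by (auto simp: in_keys_iff)
  have hi: "x s i = 0" if "i \<ge> 2" for s i
    using zero[where i = i and s = s] that by (intro frag) (auto simp: interval_adc_def)
  have z: "Poly_Mapping.lookup (x s 0) Edge = 0" "Poly_Mapping.lookup (x s 1) V0 = 0"
    "Poly_Mapping.lookup (x s 1) V1 = 0" for s
    by (rule zero; simp add: interval_adc_def)+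
  have one: "Poly_Mapping.lookup (x s 0) V0 + Poly_Mapping.lookup (x s 0) V1 = 1" for s
    using aug[of s] by (simp add: chain_aug_def sum_keys UNIV_interval interval_adc_def)
  have e: "Poly_Mapping.lookup (x s 1) Edge
      = Poly_Mapping.lookup (x True 0) V1 - Poly_Mapping.lookup (x False 0) V1" for s
  proof -
    have "Poly_Mapping.lookup (frag_extend (diff interval_adc) (x s 1)) V1 = Poly_Mapping.lookup (x s 1) Edge"
      by (simp add: lookup_ext UNIV_interval interval_adc_def lookup_minus)
    moreover have "frag_extend (diff interval_adc) (x s 1) = x True 0 - x False 0"
      using d[of s 0] by simp
    ultimately show ?thesis by (simp only: lookup_minus)
  qed
  define p where "p s = Poly_Mapping.lookup (x s 0) V1" for s
  have p01: "p s = 0 \<or> p s = 1" for s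
    using one[of s] nonneg[of s 0 V0] nonneg[of s 0 V1] unfolding p_def by linarith
  have le: "p False \<le> p True" using e[of True] nonneg[of True 1 Edge] unfolding p_def by linarith
  have x0: "x s 0 = frag_of (if p s = 1 then V1 else V0)" for s
    using one[of s] z(1)[of s] p01[of s] unfolding p_def by (intro frag) auto
  have x1: "x s 1 = (if p True = p False then 0 else frag_of Edge)" for s
    using e[of s] z(2,3)[of s] p01[of True] p01[of False] le unfolding p_def by (intro frag) auto
  have x_eq: "x s i = (if i = 0 then frag_of (if p s = 1 then V1 else V0)
      else if i = 1 then if p True = p False then 0 else frag_of Edge else 0)" for s i
  proof -
    consider "i = 0" | "i = 1" | "i \<ge> 2" by linarith
    then show ?thesis by cases (simp_all add: x0 x1[unfolded One_nat_def] hi)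
  qed
  consider "p True = 0" "p False = 0" | "p True = 1" "p False = 1" | "p True = 1" "p False = 0"
    using p01[of True] p01[of False] le by fastforce
  then show "x \<in> {nu_vertex V0, nu_vertex V1, ?e}"
  proof cases
    case 1
    then have "p s = 0" for s by (cases s) auto
    note q = this
    have "x = nu_vertex V0" by (intro ext) (simp add: x_eq nu_vertex_def q)
    then show ?thesis by simp
  next
    case 2
    then have "p s = 1" for s by (cases s) auto
    note q = this
    have "x = nu_vertex V1" by (intro ext) (simp add: x_eq nu_vertex_def q)
    then show ?thesis by simp
  next
    case 3
    then have "p s = (if s then 1 else 0)" for s by (cases s) auto
    note q = this
    have "x = ?e" by (intro ext) (simp add: x_eq q)
    then show ?thesis by simp
  qed
next
  fix x assume "x \<in> {nu_vertex V0, nu_vertex V1, ?e}"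
  moreover have "nu_vertex V0 \<in> cells (nu interval_adc)" "nu_vertex V1 \<in> cells (nu interval_adc)"
    using nu_vertex_object[of V0 interval_adc] nu_vertex_object[of V1 interval_adc]
    by (auto simp: objects_def interval_adc_def)
  moreover have "?e \<in> cells (nu interval_adc)"
    unfolding nu_cells
    by (auto simp: pos_chain_def chain_aug_def interval_adc_def intro: exI[of _ 1])
  ultimately show "x \<in> cells (nu interval_adc)" by blast
qed

text \<open>
  The \<open>n\<close>-fold tensor power of the interval, with basis the words of length \<open>n\<close> in
  \<open>V0\<close>, \<open>V1\<close>, \<open>Edge\<close>: pairs \<open>(a, w)\<close> are renamed to words \<open>a # w\<close>
  so that all the powers live over one type.
\<close>

fun cube_adc :: "nat \<Rightarrow> interval list adc" where
  "cube_adc 0 = \<lparr>basis = {[]}, deg = (\<lambda>_. 0), diff = (\<lambda>_. 0), aug = (\<lambda>_. 1)\<rparr>"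
| "cube_adc (Suc n) = rename_adc (\<lambda>(a, w). a # w) (\<lambda>w. (hd w, tl w)) (tensor_adc interval_adc (cube_adc n))"

text \<open>
  The lax Gray tensor product satisfies \<open>\<nu> K \<otimes> \<nu> L = \<nu> (K \<otimes> L)\<close> for complexes with strongly
  loop-free unital bases, and its unit is \<open>\<nu>\<close> of the complex \<open>cube_adc 0\<close>; \<open>\<nu>\<close> of \<open>interval_adc\<close> is the
  arrow category.  Hence the \<open>n\<close>-fold Gray power of the arrow category is \<open>\<nu>\<close> of \<open>cube_adc n\<close>.
  It is bipointed by the vertices \<open>(0,\<dots>,0)\<close> and \<open>(1,\<dots>,1)\<close>.
\<close>

definition nat_cube :: "nat \<Rightarrow> (bool \<Rightarrow> nat \<Rightarrow> (interval list \<Rightarrow>\<^sub>0 int)) bip_omega" where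
  "nat_cube n = bipoint (nu (cube_adc n)) (nu_vertex (replicate n V0)) (nu_vertex (replicate n V1))"

lemma cube_adc_vertex:
  assumes "length w = n" and "Edge \<notin> set w"
  shows "w \<in> basis (cube_adc n)" and "deg (cube_adc n) w = 0" and "aug (cube_adc n) w = 1"
proof -
  have "w \<in> basis (cube_adc n) \<and> deg (cube_adc n) w = 0 \<and> aug (cube_adc n) w = 1"
    using assms
    by (induction n arbitrary: w)
       (auto simp: rename_adc_def tensor_adc_def interval_adc_def length_Suc_conv image_iff)
  then show "w \<in> basis (cube_adc n)" and "deg (cube_adc n) w = 0" and "aug (cube_adc n) w = 1"
    by auto
qed

lemma nat_cube_bipointed: "bipointed (nat_cube n)"
proof -
  have "nu_vertex (replicate n V0) \<in> objects (nu (cube_adc n))"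
    "nu_vertex (replicate n V1) \<in> objects (nu (cube_adc n))"
    by (intro nu_vertex_object cube_adc_vertex; force)+
  then show ?thesis
    by (simp add: bipointed_def nat_cube_def nu_omega_category objects_def)
qed

definition nat_cube_idem_completion :: "'a bip_omega \<Rightarrow> bool" where
  "nat_cube_idem_completion X \<longleftrightarrow> bipointed X \<and> (\<exists>n. bip_retract X (nat_cube n))"

end

theory Submission
  imports Defs
begin

text \<open>
  Functors between cubes are induced by positive augmented maps between the chain complexes.  Each end vertex
  of a cube is the target of a positive contraction of its chain complex, and the existence of both
  contractions forces every positive cycle of positive degree to vanish.  Hence only the identity
  leaves the last vertex and only the identity enters the first one.

  The wedge of the cubes \<open>K\<close> and \<open>L\<close> sits in \<open>K \<otimes> L\<close> as \<open>K \<otimes> 0 \<union> 1 \<otimes> L\<close>.  The retraction sends a cell to a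
  cell of \<open>K\<close> followed by the projection to \<open>L\<close>.  On \<open>x \<otimes> y\<close> the former is \<open>x\<close> if \<open>y = 0\<close>, the contraction
  of \<open>x\<close> to the last vertex if \<open>y\<close> is an edge leaving \<open>0\<close>, and degenerate otherwise.

  The suspension of \<open>K\<close> is the quotient of \<open>K \<otimes> \<box>\<^sup>1\<close> collapsing \<open>K \<otimes> 0\<close> and \<open>K \<otimes> 1\<close>.  The quotient map is split by
  \<open>w \<mapsto> h\<^sub>0 w \<otimes> 0 + w \<otimes> e + h\<^sub>1 w \<otimes> 1\<close>, where \<open>h\<^sub>0\<close> and \<open>h\<^sub>1\<close> are the contractions.
\<close>

section \<open>Chains on words\<close>

lemma frag_extend_frag_extend:
  "frag_extend g (frag_extend f c) = frag_extend (\<lambda>a. frag_extend g (f a)) c"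
  using subset_UNIV by (induction c rule: frag_induction) (simp_all add: frag_extend_diff)

lemma frag_extend_fun_add: "frag_extend (\<lambda>a. f a + g a) c = frag_extend f c + frag_extend g c"
  by (simp add: frag_extend_def frag_cmul_distrib2 sum.distrib)

lemma frag_cmul_diff2: "frag_cmul k (a - b) = frag_cmul k a - frag_cmul k b"
  by (simp add: poly_mapping_eq_iff fun_eq_iff lookup_minus right_diff_distrib)

lemma frag_extend_fun_diff: "frag_extend (\<lambda>a. f a - g a) c = frag_extend f c - frag_extend g c"
  by (simp add: frag_extend_def frag_cmul_diff2 sum_subtractf)

lemma frag_extend_fun_uminus: "frag_extend (\<lambda>a. - f a) c = - frag_extend f c"
  using frag_extend_fun_diff[of "\<lambda>_. 0" f c] by (simp add: frag_extend_eq_0)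

lemma frag_extend_fun_zero: "frag_extend (\<lambda>a. 0) c = 0"
  by (simp add: frag_extend_eq_0)

lemma frag_extend_fun_cmul: "frag_extend (\<lambda>a. frag_cmul k (f a)) c = frag_cmul k (frag_extend f c)"
  by (simp add: frag_extend_def frag_cmul_sum mult.commute)

lemma frag_extend_frag_of: "frag_extend frag_of c = c"
  by (simp add: frag_expansion[symmetric])

lemmas frag_linear = frag_extend_frag_extend frag_extend_fun_add frag_extend_fun_diff
  frag_extend_fun_uminus frag_extend_fun_zero frag_extend_fun_cmul frag_extend_frag_of
  frag_extend_add frag_extend_diff frag_extend_minus frag_extend_cmul
  frag_cmul_diff2 frag_cmul_distrib2

abbreviation lin_cons :: "'a \<Rightarrow> ('a list \<Rightarrow>\<^sub>0 int) \<Rightarrow> ('a list \<Rightarrow>\<^sub>0 int)" where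
  "lin_cons x \<equiv> frag_extend (\<lambda>w. frag_of (x # w))"

abbreviation lin_app :: "('a list \<Rightarrow>\<^sub>0 int) \<Rightarrow> 'a list \<Rightarrow> ('a list \<Rightarrow>\<^sub>0 int)" where
  "lin_app c v \<equiv> frag_extend (\<lambda>u. frag_of (u @ v)) c"

abbreviation word_deg :: "interval list \<Rightarrow> nat" where
  "word_deg w \<equiv> count_list w Edge"

abbreviation word_sign :: "interval list \<Rightarrow> int" where
  "word_sign w \<equiv> (-1) ^ word_deg w"

text \<open>The differential of the tensor powers of the interval for words of every length at once,
  so that arguments can recurse on the word. The minus sign is the Leibniz sign of a leading
  \<open>Edge\<close>; \<open>cube_adc_words\<close> makes the comparison.\<close>

fun word_diff :: "interval list \<Rightarrow> (interval list \<Rightarrow>\<^sub>0 int)" where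
  "word_diff [] = 0"
| "word_diff (x # w) = (if x = Edge then frag_of (V1 # w) - frag_of (V0 # w) - lin_cons x (word_diff w)
                        else lin_cons x (word_diff w))"

abbreviation chain_diff :: "(interval list \<Rightarrow>\<^sub>0 int) \<Rightarrow> (interval list \<Rightarrow>\<^sub>0 int)" where
  "chain_diff \<equiv> frag_extend word_diff"

section \<open>Contractions of a cube to its two end vertices\<close>

definition endpoint :: "bool \<Rightarrow> interval" where
  "endpoint s = (if s then V1 else V0)"

lemma endpoint_simps [simp]:
  "endpoint s \<noteq> Edge" "Edge \<noteq> endpoint s" "endpoint True = V1" "endpoint False = V0"
  "endpoint s = endpoint t \<longleftrightarrow> s = t"
  by (auto simp: endpoint_def)

lemma interval_endpoint_cases: obtains "x = Edge" | "x = endpoint s" | "x = endpoint (\<not> s)"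
  by (cases x; cases s) (auto simp: endpoint_def)

fun collapse :: "bool \<Rightarrow> interval list \<Rightarrow> (interval list \<Rightarrow>\<^sub>0 int)" where
  "collapse s [] = frag_of []"
| "collapse s (x # w) = (if x = Edge then 0 else lin_cons (endpoint s) (collapse s w))"

text \<open>Each term turns one letter \<open>endpoint (\<not> s)\<close> into \<open>Edge\<close>,
  keeps the letters before it and collapses those after it. On a vertex this is a path of edges, to
  the last vertex for \<open>s = True\<close> and from the first one for
  \<open>s = False\<close>.\<close>

fun contract :: "bool \<Rightarrow> interval list \<Rightarrow> (interval list \<Rightarrow>\<^sub>0 int)" where
  "contract s [] = 0"
| "contract s (x # w) = lin_cons x (contract s w)
      + (if x = endpoint (\<not> s) then lin_cons Edge (collapse s w) else 0)"

lemma collapse_eq: "collapse s w = (if Edge \<in> set w then 0 else frag_of (replicate (length w) (endpoint s)))"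
  by (induction w) auto

lemma collapse_lin_cons:
  "frag_extend (collapse s) (lin_cons x c) =
     (if x = Edge then 0 else lin_cons (endpoint s) (frag_extend (collapse s) c))"
  by (simp add: frag_linear)

lemma collapse_word_diff: "frag_extend (collapse s) (word_diff w) = 0"
  by (induction w) (simp_all add: collapse_lin_cons frag_extend_diff)

lemma word_diff_vertex: "Edge \<notin> set w \<Longrightarrow> word_diff w = 0"
  by (induction w) auto

lemma chain_diff_collapse: "chain_diff (collapse s w) = 0"
  by (auto simp: collapse_eq intro!: word_diff_vertex)

lemma chain_diff_lin_cons:
  "chain_diff (lin_cons x c) = (if x = Edge then lin_cons V1 c - lin_cons V0 c - lin_cons x (chain_diff c)
                                else lin_cons x (chain_diff c))"
  by (simp add: frag_linear)

lemma contract_lin_cons: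
  "frag_extend (contract s) (lin_cons x c) = lin_cons x (frag_extend (contract s) c)
     + (if x = endpoint (\<not> s) then lin_cons Edge (frag_extend (collapse s) c) else 0)"
  by (simp add: frag_linear)

text \<open>By induction on the first letter; at \<open>Edge\<close>, the collapse term of the
  induction hypothesis cancels against the extra edge over one of the two end faces. Multiplying
  \<open>contract\<close> by \<open>word_sign\<close> would give the usual chain homotopy; the
  unsigned form keeps it positive.\<close>

lemma chain_diff_contract:
  "chain_diff (contract s w) = frag_extend (contract s) (word_diff w)
     + frag_cmul (if s then 1 else -1) (collapse s w - frag_cmul (word_sign w) (frag_of w))"
proof (induction w)
  case Nil
  then show ?case by simp
next
  case (Cons x w)
  \<comment> \<open>Splitting by \<open>s\<close> removes the scalar before rewriting.\<close>
  have IH: "s \<Longrightarrow> chain_diff (contract True w) = frag_extend (contract True) (word_diff w)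
       + (collapse True w - frag_cmul (word_sign w) (frag_of w))"
    "\<not> s \<Longrightarrow> chain_diff (contract False w) = frag_extend (contract False) (word_diff w)
       - (collapse False w - frag_cmul (word_sign w) (frag_of w))"
    using Cons by (simp_all add: frag_cmul_diff2)
  show ?case
    by (cases x rule: interval_endpoint_cases[where s = s]; cases s)
       (simp_all add: IH chain_diff_lin_cons contract_lin_cons collapse_word_diff chain_diff_collapse
         frag_extend_add frag_extend_diff frag_extend_minus frag_extend_cmul frag_cmul_diff2 frag_cmul_distrib2
         algebra_simps flip: minus_frag_cmul)
qed

text \<open>Concatenation is the tensor product of words, so this is the Leibniz rule at an
  arbitrary cut.\<close>

lemma word_diff_append:
  "word_diff (u @ v) = lin_app (word_diff u) v
     + frag_cmul (word_sign u) (frag_extend (\<lambda>w. frag_of (u @ w)) (word_diff v))"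
  by (induction u) (auto simp: frag_linear)


section \<open>Positive chains and positive cycles of a cube\<close>

definition cube_chain :: "nat \<Rightarrow> nat \<Rightarrow> (interval list \<Rightarrow>\<^sub>0 int) \<Rightarrow> bool" where
  "cube_chain n i c \<longleftrightarrow> Poly_Mapping.keys c \<subseteq> {w. length w = n \<and> word_deg w = i}
     \<and> (\<forall>w. 0 \<le> Poly_Mapping.lookup c w)"

lemma cube_chain_0 [simp]: "cube_chain n i 0"
  by (simp add: cube_chain_def)

lemma cube_chain_frag_of [simp]: "cube_chain n i (frag_of w) \<longleftrightarrow> length w = n \<and> word_deg w = i"
  by (auto simp: cube_chain_def)

lemma cube_chain_add: "cube_chain n i a \<Longrightarrow> cube_chain n i b \<Longrightarrow> cube_chain n i (a + b)"
  using Poly_Mapping.keys_add[of a b] by (auto simp: cube_chain_def lookup_add)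

lemma cube_chain_frag_extend:
  assumes "cube_chain m i c"
    and "\<And>w. length w = m \<Longrightarrow> word_deg w = i \<Longrightarrow> cube_chain n j (f w)"
  shows "cube_chain n j (frag_extend f c)"
proof -
  have "0 \<le> Poly_Mapping.lookup (frag_extend f c) w" for w
    unfolding frag_extend_def lookup_sum
    using assms by (intro sum_nonneg) (auto simp: cube_chain_def)
  moreover have "Poly_Mapping.keys (frag_extend f c) \<subseteq> {w. length w = n \<and> word_deg w = j}"
    using keys_frag_extend[of f c] assms unfolding cube_chain_def by blast
  ultimately show ?thesis by (simp add: cube_chain_def)
qed

text \<open>Nonnegative coefficients cannot cancel.\<close>

lemma cube_chain_add_eq_0:
  assumes "cube_chain n i a" "cube_chain n i b" "a + b = 0"
  shows "a = 0"
proof (rule poly_mapping_eqI)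
  fix w
  have "Poly_Mapping.lookup a w + Poly_Mapping.lookup b w = 0"
    using assms(3) by (metis lookup_add lookup_zero)
  then show "Poly_Mapping.lookup a w = Poly_Mapping.lookup 0 w"
    using assms(1,2) unfolding cube_chain_def by (metis add_nonneg_eq_0_iff lookup_zero)
qed

lemma cube_chain_dim:
  assumes "cube_chain n i c" "n < i"
  shows "c = 0"
proof -
  have "w \<notin> Poly_Mapping.keys c" for w
    using assms count_le_length[of w Edge] unfolding cube_chain_def by auto
  then have "Poly_Mapping.keys c = {}" by blast
  then show ?thesis by simp
qed

lemma word_deg_vertex: "Edge \<notin> set w \<Longrightarrow> word_deg w = 0"
  by (simp add: count_notin)

lemma word_deg_0_iff: "word_deg w = 0 \<longleftrightarrow> Edge \<notin> set w"
  by (simp add: count_list_0_iff)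

text \<open>The extra edge gives the right degree because \<open>collapse s w\<close> vanishes
  unless \<open>w\<close> is a vertex.\<close>

lemma cube_chain_contract: "cube_chain (length w) (Suc (word_deg w)) (contract s w)"
proof (induction w)
  case (Cons x w)
  have "cube_chain (length (x # w)) (Suc (word_deg (x # w))) (lin_cons x (contract s w))"
    by (rule cube_chain_frag_extend[OF Cons]) auto
  moreover have "cube_chain (length (x # w)) (Suc (word_deg (x # w)))
      (if x = endpoint (\<not> s) then lin_cons Edge (collapse s w) else 0)"
    by (auto simp: collapse_eq word_deg_vertex)
  ultimately show ?case by (simp add: cube_chain_add)
qed simp

lemma keys_word_diff:
  "v \<in> Poly_Mapping.keys (word_diff w) \<Longrightarrow> length v = length w \<and> Suc (word_deg v) = word_deg w"
proof (induction w arbitrary: v)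
  case (Cons x w)
  have "v \<in> Poly_Mapping.keys (lin_cons x (word_diff w)) \<union> (if x = Edge then {V1 # w, V0 # w} else {})"
  proof (cases "x = Edge")
    case True
    then show ?thesis
      using Cons.prems keys_diff[of "frag_of (V1 # w) - frag_of (V0 # w)" "lin_cons x (word_diff w)"]
        keys_diff[of "frag_of (V1 # w)" "frag_of (V0 # w)"] by auto
  next
    case False
    then show ?thesis using Cons.prems by simp
  qed
  then consider "v \<in> Poly_Mapping.keys (lin_cons x (word_diff w))" | "x = Edge" "v \<in> {V1 # w, V0 # w}"
    by (auto split: if_splits)
  then show ?case
  proof cases
    case 1
    then obtain u where "u \<in> Poly_Mapping.keys (word_diff w)" "v = x # u"
      using keys_frag_extend[of "\<lambda>w. frag_of (x # w)" "word_diff w"] by auto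
    then show ?thesis using Cons.IH[of u] by auto
  qed auto
qed simp

lemma collapse_pos_deg: "cube_chain n i c \<Longrightarrow> 0 < i \<Longrightarrow> frag_extend (collapse s) c = 0"
  by (rule frag_extend_eq_0)
    (metis (mono_tags, lifting) collapse_eq cube_chain_def mem_Collect_eq not_gr_zero subsetD word_deg_vertex)

lemma chain_diff_contract_chain:
  assumes "cube_chain n i c"
  shows "chain_diff (frag_extend (contract s) c) = frag_extend (contract s) (chain_diff c)
     + frag_cmul (if s then 1 else -1) (frag_extend (collapse s) c - frag_cmul ((-1) ^ i) c)"
proof -
  have "chain_diff (frag_extend (contract s) c) = frag_extend (\<lambda>w. frag_extend (contract s) (word_diff w)
     + frag_cmul (if s then 1 else -1) (collapse s w - frag_cmul ((-1) ^ i) (frag_of w))) c"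
    unfolding frag_extend_frag_extend
    by (rule frag_extend_eq) (use assms in \<open>auto simp: cube_chain_def chain_diff_contract\<close>)
  also have "\<dots> = frag_extend (contract s) (chain_diff c)
     + frag_cmul (if s then 1 else -1) (frag_extend (collapse s) c - frag_cmul ((-1) ^ i) c)"
    unfolding frag_linear ..
  finally show ?thesis .
qed

text \<open>
  The two contractions of a positive cycle \<open>c\<close> have opposite boundaries, so their sum is again a positive
  cycle, of one degree more; if it vanishes then so do its two positive summands, and with them \<open>c\<close>.
\<close>

lemma positive_cycle_eq_0:
  assumes "cube_chain n i c" "0 < i" "chain_diff c = 0"
  shows "c = 0"
  using assms
\<comment> \<open>Downward induction on the degree: the measure is 0 exactly when
  \<open>n < i\<close>, where every chain is zero.\<close>
proof (induction "Suc n - i" arbitrary: i c)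
  case 0
  then show ?case by (intro cube_chain_dim) auto
next
  case (Suc k)
  let ?h = "\<lambda>s. frag_extend (contract s) c"
  have h: "cube_chain n (Suc i) (?h s)" for s
    using cube_chain_contract by (intro cube_chain_frag_extend[OF Suc.prems(1)]) auto
  have d: "chain_diff (?h s) = frag_cmul (if s then 1 else -1) (- frag_cmul ((-1) ^ i) c)" for s
    unfolding chain_diff_contract_chain[OF Suc.prems(1)]
    using Suc.prems by (simp add: collapse_pos_deg)
  have "?h False + ?h True = 0"
  proof (rule Suc.hyps(1))
    show "k = Suc n - Suc i" using Suc.hyps(2) by simp
    show "cube_chain n (Suc i) (?h False + ?h True)" by (intro cube_chain_add h)
    show "chain_diff (?h False + ?h True) = 0"
      by (simp add: frag_extend_add d flip: minus_frag_cmul)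
  qed simp
  then have "?h False = 0" by (rule cube_chain_add_eq_0[OF h h])
  then have "chain_diff (?h False) = 0" by simp
  then show ?case unfolding d by simp
qed

section \<open>Cells of a cube in terms of words\<close>

lemma cube_adc_words:
  "basis (cube_adc n) = {w. length w = n}"
  "length w = n \<Longrightarrow> deg (cube_adc n) w = word_deg w"
  "length w = n \<Longrightarrow> aug (cube_adc n) w = (if Edge \<in> set w then 0 else 1)"
  "length w = n \<Longrightarrow> diff (cube_adc n) w = word_diff w"
proof -
  show "basis (cube_adc n) = {w. length w = n}"
  proof (induction n)
    case (Suc n)
    then show ?case
      by (auto simp: rename_adc_def tensor_adc_def interval_adc_def length_Suc_conv image_iff)
  qed auto
  show "length w = n \<Longrightarrow> deg (cube_adc n) w = word_deg w"
    by (induction n arbitrary: w)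
       (auto simp: rename_adc_def tensor_adc_def interval_adc_def length_Suc_conv)
  show "length w = n \<Longrightarrow> aug (cube_adc n) w = (if Edge \<in> set w then 0 else 1)"
    by (induction n arbitrary: w)
       (auto simp: rename_adc_def tensor_adc_def interval_adc_def length_Suc_conv)
  show "length w = n \<Longrightarrow> diff (cube_adc n) w = word_diff w"
    by (induction n arbitrary: w)
       (auto simp: rename_adc_def tensor_adc_def tensor_chain_def interval_adc_def length_Suc_conv frag_linear)
qed

text \<open>The augmentation with values in the chains of the 0-cube instead of the integers, so
  that the linear rules for \<open>frag_extend\<close> treat it like any chain map.\<close>

definition word_aug :: "interval list \<Rightarrow> (interval list \<Rightarrow>\<^sub>0 int)" where
  "word_aug w = (if Edge \<in> set w then 0 else frag_of [])"

lemma word_aug_chain: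
  assumes "cube_chain n i c"
  shows "frag_extend word_aug c = frag_cmul (chain_aug (cube_adc n) c) (frag_of [])"
proof -
  have "frag_extend word_aug c
      = (\<Sum>w\<in>Poly_Mapping.keys c. frag_cmul (Poly_Mapping.lookup c w * aug (cube_adc n) w) (frag_of []))"
    unfolding frag_extend_def
    by (rule sum.cong) (use assms in \<open>auto simp: cube_chain_def word_aug_def cube_adc_words(3)\<close>)
  moreover have "(\<Sum>w\<in>A. frag_cmul (g w) x) = frag_cmul (\<Sum>w\<in>A. g w) x" for A g and x :: "'b \<Rightarrow>\<^sub>0 int"
    by (induction A rule: infinite_finite_induct) (simp_all add: frag_cmul_distrib)
  ultimately show ?thesis by (simp add: chain_aug_def)
qed

lemma pos_chain_cube: "pos_chain (cube_adc n) i c \<longleftrightarrow> cube_chain n i c"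
  unfolding pos_chain_def cube_chain_def using cube_adc_words(1,2)[where n = n] by auto

text \<open>The finiteness of a cell is supplied by \<open>cube_chain_dim\<close>: chains of an
  \<open>n\<close>-cube vanish above degree \<open>n\<close>.\<close>

lemma nat_cube_cells: "z \<in> cells (nat_cube n) \<longleftrightarrow>
    (\<forall>s i. cube_chain n i (z s i)) \<and>
    (\<forall>s i. chain_diff (z s (Suc i)) = z True i - z False i) \<and>
    (\<forall>s. frag_extend word_aug (z s 0) = frag_of [])"
proof -
  have d: "frag_extend (diff (cube_adc n)) c = chain_diff c" if "cube_chain n i c" for i c
    using that by (intro frag_extend_eq) (auto simp: cube_chain_def cube_adc_words(4))
  have a: "chain_aug (cube_adc n) c = 1 \<longleftrightarrow> frag_extend word_aug c = frag_of []" if "cube_chain n 0 c" for c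
  proof -
    have "frag_cmul k (frag_of ([] :: interval list)) = frag_of [] \<longleftrightarrow> k = 1" for k
    proof
      assume "frag_cmul k (frag_of ([] :: interval list)) = frag_of []"
      from arg_cong[OF this, of "\<lambda>c. Poly_Mapping.lookup c []"] show "k = 1" by simp
    qed simp
    then show ?thesis unfolding word_aug_chain[OF that] by simp
  qed
  have fin: "\<forall>s. \<forall>i>n. z s i = 0" if "\<forall>s i. cube_chain n i (z s i)"
    using that cube_chain_dim by blast
  show ?thesis
  proof (cases "\<forall>s i. cube_chain n i (z s i)")
    case True
    then have "\<exists>N. \<forall>s. \<forall>i>N. z s i = 0" using fin by blast
    with True show ?thesis
      unfolding nat_cube_def bipoint_simps nu_cells pos_chain_cube
      by (simp add: d[OF True[rule_format]] a[OF True[rule_format]])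
  next
    case False
    then show ?thesis
      unfolding nat_cube_def bipoint_simps nu_cells pos_chain_cube by blast
  qed
qed

lemma lookup_word_aug:
  assumes "cube_chain n 0 c"
  shows "Poly_Mapping.lookup (frag_extend word_aug c) [] = (\<Sum>w\<in>Poly_Mapping.keys c. Poly_Mapping.lookup c w)"
proof -
  have "frag_extend word_aug c = frag_extend (\<lambda>_. frag_of []) c"
    by (rule frag_extend_eq) (use assms in \<open>auto simp: cube_chain_def word_aug_def count_list_0_iff\<close>)
  then show ?thesis by (simp add: frag_extend_def lookup_sum)
qed

text \<open>Positive integer coefficients with sum one: there is a single one. So the degree 0
  components of a cell are vertices.\<close>

lemma cube_vertexE:
  assumes "cube_chain n 0 c" "frag_extend word_aug c = frag_of []"
  obtains w where "length w = n" "Edge \<notin> set w" "c = frag_of w"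
proof -
  have v: "length w = n" "Edge \<notin> set w" if "w \<in> Poly_Mapping.keys c" for w
    using assms(1) that by (auto simp: cube_chain_def word_deg_0_iff)
  have pos: "1 \<le> Poly_Mapping.lookup c w" if "w \<in> Poly_Mapping.keys c" for w
    using assms(1) that unfolding cube_chain_def in_keys_iff by (metis int_one_le_iff_zero_less order_le_less)
  have sum: "(\<Sum>w\<in>Poly_Mapping.keys c. Poly_Mapping.lookup c w) = 1"
    using lookup_word_aug[OF assms(1)] assms(2) by simp
  then have "Poly_Mapping.keys c \<noteq> {}" by auto
  then obtain w where w: "w \<in> Poly_Mapping.keys c" by blast
  have "of_nat (card (Poly_Mapping.keys c - {w})) \<le> (\<Sum>w\<in>Poly_Mapping.keys c - {w}. Poly_Mapping.lookup c w)"
    using sum_mono[of "Poly_Mapping.keys c - {w}" "\<lambda>_. 1 :: int" "Poly_Mapping.lookup c"] pos by auto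
  also have "\<dots> = 1 - Poly_Mapping.lookup c w" using sum w by (simp add: sum.remove)
  finally have "Poly_Mapping.lookup c w = 1" "card (Poly_Mapping.keys c - {w}) = 0"
    using pos[OF w] by linarith+
  moreover from this(2) have "Poly_Mapping.keys c \<subseteq> {w}" by simp
  ultimately have "c = frag_of w"
    by (intro poly_mapping_eqI) (auto simp: in_keys_iff when_def)
  then show ?thesis using that v[OF w] by blast
qed

text \<open>Closing the edges of \<open>z\<close> up with the contraction of its other end gives a
  positive cycle. It vanishes, so \<open>z\<close> has no edges, and each higher component is then a
  positive cycle in turn. For \<open>s = True\<close> the source is prescribed, for
  \<open>s = False\<close> the target.\<close>

lemma cube_cell_const:
  assumes z: "z \<in> cells (nat_cube n)" and e: "z (\<not> s) 0 = frag_of (replicate n (endpoint s))"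
  shows "z = nu_vertex (replicate n (endpoint s))"
proof -
  note z = z[unfolded nat_cube_cells]
  then have zc: "cube_chain n i (z t i)" and zd: "chain_diff (z t (Suc i)) = z True i - z False i" for t i
    by blast+
  obtain v where v: "length v = n" "Edge \<notin> set v" "z s 0 = frag_of v"
    using z cube_vertexE[of n "z s 0"] by blast
  have 1: "z t (Suc 0) = 0" for t
  proof -
    have h: "cube_chain n (Suc 0) (contract s v)"
      using cube_chain_contract[of v s] v by (simp add: word_deg_vertex)
    \<comment> \<open>Written through \<open>z s 0\<close> and \<open>z (\<not> s) 0\<close> with
      the same scalar, the two boundaries are visibly opposite.\<close>
    have "z True 0 - z False 0 = frag_cmul (if s then 1 else -1) (z s 0 - z (\<not> s) 0)"
      by (cases s) auto
    moreover have "chain_diff (contract s v) = frag_cmul (if s then 1 else -1) (z (\<not> s) 0 - z s 0)"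
      using v e by (simp add: chain_diff_contract word_diff_vertex collapse_eq word_deg_vertex)
    ultimately have "chain_diff (z t (Suc 0) + contract s v) = 0"
      by (simp add: zd frag_extend_add frag_cmul_diff2)
    then have "z t (Suc 0) + contract s v = 0"
      by (rule positive_cycle_eq_0[OF cube_chain_add[OF zc h] zero_less_Suc])
    then show ?thesis by (rule cube_chain_add_eq_0[OF zc h])
  qed
  have "z t (Suc i) = 0" for t i
  proof (induction i arbitrary: t)
    case (Suc i)
    then have "chain_diff (z t (Suc (Suc i))) = 0" by (simp add: zd)
    then show ?case by (rule positive_cycle_eq_0[OF zc zero_less_Suc])
  qed (rule 1)
  moreover have "z True 0 = z False 0"
    using zd[of True 0] 1[of True] by simp
  then have "z t 0 = frag_of (replicate n (endpoint s))" for t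
    using e by (cases t; cases s) auto
  ultimately show ?thesis
    by (auto simp: nu_vertex_def fun_eq_iff gr0_conv_Suc)
qed

section \<open>Functors between cubes\<close>

lemma nat_cube_bd: "bd (nat_cube n) s k z = (\<lambda>t i. if i < k then z t i else if i = k then z s k else 0)"
  by (simp add: nat_cube_def nu_bd)

lemma nat_cube_composable:
  "tgt (nat_cube n) k x = src (nat_cube n) k y \<longleftrightarrow> (\<forall>s. \<forall>i<k. x s i = y s i) \<and> x True k = y False k"
  by (simp add: nat_cube_def nu_composable)

lemma nat_cube_gcomp:
  assumes "tgt (nat_cube n) k x = src (nat_cube n) k y"
  shows "gcomp (nat_cube n) k x y =
    (\<lambda>s i. if i < k then x s i else if i = k then (if s then y True k else x False k) else x s i + y s i)"
  using assms by (simp add: nat_cube_def nu_gcomp)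

lemma nat_cube_omega: "omega_category (nat_cube n)"
  using nat_cube_bipointed by (simp add: bipointed_def)

lemma nat_cube_cellsD:
  assumes "z \<in> cells (nat_cube n)"
  shows "cube_chain n i (z s i)" "chain_diff (z s (Suc i)) = z True i - z False i"
    "frag_extend word_aug (z s 0) = frag_of []"
  using assms unfolding nat_cube_cells by blast+

lemma nat_cube_pt: "pt0 (nat_cube n) = nu_vertex (replicate n V0)" "pt1 (nat_cube n) = nu_vertex (replicate n V1)"
  by (simp_all add: nat_cube_def)

lemma cube_chain_cong:
  assumes "cube_chain n i c" "\<And>w. length w = n \<Longrightarrow> word_deg w = i \<Longrightarrow> f w = g w"
  shows "frag_extend f c = frag_extend g c"
  using assms by (intro frag_extend_eq) (auto simp: cube_chain_def)

definition lift_chain :: "('a \<Rightarrow> 'b \<Rightarrow>\<^sub>0 int) \<Rightarrow> (bool \<Rightarrow> nat \<Rightarrow> ('a \<Rightarrow>\<^sub>0 int)) \<Rightarrow> (bool \<Rightarrow> nat \<Rightarrow> ('b \<Rightarrow>\<^sub>0 int))" where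
  "lift_chain f z = (\<lambda>s i. frag_extend f (z s i))"

lemma lift_chain_vertex: "lift_chain f (nu_vertex w) = (\<lambda>_ i. if i = 0 then f w else 0)"
  by (auto simp: lift_chain_def nu_vertex_def fun_eq_iff)

text \<open>Functoriality of \<open>nu\<close>: the three hypotheses preserve the three conditions
  on a cell, and boundaries and composites are linear in the components.\<close>

lemma strict_functor_lift_chain:
  assumes chain: "\<And>w. length w = m \<Longrightarrow> cube_chain n (word_deg w) (f w)"
    and diff: "\<And>w. length w = m \<Longrightarrow> chain_diff (f w) = frag_extend f (word_diff w)"
    and aug: "\<And>w. length w = m \<Longrightarrow> frag_extend word_aug (f w) = word_aug w"
  shows "strict_functor (lift_chain f) (nat_cube m) (nat_cube n)"
  unfolding strict_functor_def
proof (intro conjI ballI allI impI)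
  fix z assume z: "z \<in> cells (nat_cube m)"
  note zc = nat_cube_cellsD(1)[OF z]
  have "cube_chain n i (lift_chain f z s i)" for s i
    unfolding lift_chain_def using chain by (intro cube_chain_frag_extend[OF zc]) blast
  moreover have "chain_diff (lift_chain f z s (Suc i)) = lift_chain f z True i - lift_chain f z False i" for s i
  proof -
    have "chain_diff (lift_chain f z s (Suc i)) = frag_extend f (chain_diff (z s (Suc i)))"
      unfolding lift_chain_def frag_extend_frag_extend
      by (rule cube_chain_cong[OF zc diff])
    then show ?thesis by (simp add: nat_cube_cellsD(2)[OF z] lift_chain_def frag_extend_diff)
  qed
  moreover have "frag_extend word_aug (lift_chain f z s 0) = frag_of []" for s
  proof -
    have "frag_extend word_aug (lift_chain f z s 0) = frag_extend word_aug (z s 0)"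
      unfolding lift_chain_def frag_extend_frag_extend
      by (rule cube_chain_cong[OF zc aug])
    then show ?thesis by (simp add: nat_cube_cellsD(3)[OF z])
  qed
  ultimately show "lift_chain f z \<in> cells (nat_cube n)" by (simp add: nat_cube_cells)
  show "lift_chain f (bd (nat_cube m) s k z) = bd (nat_cube n) s k (lift_chain f z)" for s k
    by (auto simp: nat_cube_bd lift_chain_def fun_eq_iff)
  fix y k assume c: "tgt (nat_cube m) k z = src (nat_cube m) k y"
  then have c': "tgt (nat_cube n) k (lift_chain f z) = src (nat_cube n) k (lift_chain f y)"
    by (simp add: nat_cube_composable lift_chain_def)
  show "lift_chain f (gcomp (nat_cube m) k z y) = gcomp (nat_cube n) k (lift_chain f z) (lift_chain f y)"
    unfolding nat_cube_gcomp[OF c] nat_cube_gcomp[OF c']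
    by (auto simp: lift_chain_def fun_eq_iff frag_extend_add)
qed

text \<open>A word cut at position \<open>m\<close> is a basis element of a tensor product; maps out
  of it are given on pairs.\<close>

definition split_word :: "nat \<Rightarrow> ('a list \<Rightarrow> 'a list \<Rightarrow> 'b) \<Rightarrow> 'a list \<Rightarrow> 'b" where
  "split_word m g w = g (take m w) (drop m w)"

lemma split_word_append [simp]: "length u = m \<Longrightarrow> split_word m g (u @ v) = g u v"
  by (simp add: split_word_def)

lemma split_word_diff:
  assumes "length u = m"
  shows "frag_extend (split_word m g) (word_diff (u @ v)) = frag_extend (\<lambda>u. g u v) (word_diff u)
     + frag_cmul (word_sign u) (frag_extend (g u) (word_diff v))"
proof -
  have "frag_extend (\<lambda>u. split_word m g (u @ v)) (word_diff u) = frag_extend (\<lambda>u. g u v) (word_diff u)"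
    using assms keys_word_diff by (intro frag_extend_eq) auto
  then show ?thesis
    using assms by (simp add: word_diff_append frag_extend_add frag_extend_cmul frag_extend_frag_extend)
qed

lemma strict_functor_lift_split_word:
  assumes chain: "\<And>u v. length u = m \<Longrightarrow> length v = n \<Longrightarrow> cube_chain k (word_deg u + word_deg v) (g u v)"
    and diff: "\<And>u v. length u = m \<Longrightarrow> length v = n \<Longrightarrow> chain_diff (g u v) =
      frag_extend (\<lambda>u. g u v) (word_diff u) + frag_cmul (word_sign u) (frag_extend (g u) (word_diff v))"
    and aug: "\<And>u v. length u = m \<Longrightarrow> length v = n \<Longrightarrow>
      frag_extend word_aug (g u v) = (if Edge \<in> set u \<or> Edge \<in> set v then 0 else frag_of [])"
  shows "strict_functor (lift_chain (split_word m g)) (nat_cube (m + n)) (nat_cube k)"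
proof (rule strict_functor_lift_chain)
  fix w :: "interval list" assume "length w = m + n"
  then obtain u v where w: "w = u @ v" and l: "length u = m" "length v = n"
    by (metis append_take_drop_id length_drop length_take min_absorb2 add_diff_cancel_left' le_add1)
  show "cube_chain k (word_deg w) (split_word m g w)"
    using chain[OF l] l by (simp add: w)
  show "chain_diff (split_word m g w) = frag_extend (split_word m g) (word_diff w)"
    unfolding w split_word_diff[OF l(1)] using diff[OF l] l by simp
  show "frag_extend word_aug (split_word m g w) = word_aug w"
    using aug[OF l] l by (simp add: w word_aug_def)
qed

text \<open>Vertices occur among the faces of \<open>w\<close> only if \<open>w\<close> has degree
  one, as its two ends with opposite signs.\<close>

lemma word_diff_vertex_faces: "frag_extend (\<lambda>v. if Edge \<in> set v then 0 else c) (word_diff w) = 0"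
proof (induction w)
  case (Cons x w)
  have "frag_extend (\<lambda>v. if Edge \<in> set v then 0 else c) (lin_cons x d)
      = (if x = Edge then 0 else frag_extend (\<lambda>v. if Edge \<in> set v then 0 else c) d)" for x d
    by (simp add: frag_linear)
  then show ?case using Cons by (simp add: frag_extend_diff)
qed simp

lemma word_aug_pos_deg: "cube_chain n i c \<Longrightarrow> 0 < i \<Longrightarrow> frag_extend word_aug c = 0"
  by (rule frag_extend_eq_0)
    (metis (mono_tags, lifting) word_aug_def cube_chain_def mem_Collect_eq not_gr_zero subsetD word_deg_vertex)

section \<open>Projections and inclusions of cubes\<close>

text \<open>The augmentation of the left factor tensored with the identity of the right one.\<close>

abbreviation proj_right :: "interval list \<Rightarrow> interval list \<Rightarrow> (interval list \<Rightarrow>\<^sub>0 int)" where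
  "proj_right u v \<equiv> (if Edge \<in> set u then 0 else frag_of v)"

lemma strict_functor_proj_right:
  "strict_functor (lift_chain (split_word m proj_right)) (nat_cube (m + n)) (nat_cube n)"
proof (rule strict_functor_lift_split_word)
  fix u v :: "interval list"
  have "frag_extend (proj_right u) (word_diff v) = (if Edge \<in> set u then 0 else word_diff v)"
    by (simp add: frag_linear)
  then show "chain_diff (proj_right u v) = frag_extend (\<lambda>u. proj_right u v) (word_diff u)
      + frag_cmul (word_sign u) (frag_extend (proj_right u) (word_diff v))"
    by (simp add: word_diff_vertex_faces)
qed (auto simp: word_aug_def)

text \<open>For \<open>i = 0\<close> this singles out the bottom vertex, for \<open>i = 1\<close>
  the edges leaving it.\<close>

definition bottom_faces :: "nat \<Rightarrow> 'a \<Rightarrow> interval list \<Rightarrow> 'a::zero" where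
  "bottom_faces i c v = (if word_deg v = i \<and> V1 \<notin> set v then c else 0)"

lemma bottom_faces_lin_cons:
  "frag_extend (bottom_faces i c) (lin_cons x d) = (if x = V0 then frag_extend (bottom_faces i c) d
     else if x = Edge \<and> 0 < i then frag_extend (bottom_faces (i - 1) c) d else 0)"
  unfolding frag_extend_frag_extend frag_extend_of
  by (cases x) (auto intro!: frag_extend_eq frag_extend_eq_0 simp: bottom_faces_def)

lemma bottom_faces_Cons:
  "bottom_faces i c (x # w) = (if x = V0 then bottom_faces i c w
     else if x = Edge \<and> 0 < i then bottom_faces (i - 1) c w else 0)"
  by (cases x) (auto simp: bottom_faces_def)

text \<open>The bottom vertex is a face only as the source of an edge leaving it, whence the minus
  sign.\<close>

lemma bottom_faces_0_diff: "frag_extend (bottom_faces 0 c) (word_diff w) = - bottom_faces 1 c w"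
proof (induction w)
  case (Cons x w)
  then show ?case by (cases x) (simp_all add: frag_extend_diff bottom_faces_lin_cons bottom_faces_Cons)
qed (simp add: bottom_faces_def)

text \<open>A square at the bottom vertex has two edges leaving that vertex, and they occur in its
  boundary with opposite signs.\<close>

lemma bottom_faces_1_diff: "frag_extend (bottom_faces 1 c) (word_diff w) = 0"
proof (induction w)
  case (Cons x w)
  then show ?case
    by (cases x) (simp_all add: frag_extend_diff bottom_faces_lin_cons bottom_faces_Cons bottom_faces_0_diff)
qed simp

text \<open>
  The component in the left factor of the projection of the cube \<open>K \<otimes> L\<close> onto the wedge \<open>K \<or> L\<close>.  It is the
  identity over the bottom vertex of \<open>L\<close> and constant at the top vertex of \<open>K\<close> over the other vertices, so
  that an edge of \<open>L\<close> leaving the bottom vertex has to carry the contraction of \<open>K\<close> to its top vertex.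
\<close>

definition proj_left :: "interval list \<Rightarrow> interval list \<Rightarrow> (interval list \<Rightarrow>\<^sub>0 int)" where
  "proj_left u v = (if Edge \<in> set v then 0 else collapse True u)
     + bottom_faces 0 (frag_of u - collapse True u) v + bottom_faces 1 (contract True u) v"

text \<open>The sum in \<open>proj_left_def\<close> suits the differential but contains a
  subtraction; case by case it disappears, and positivity can be read off.\<close>

lemma proj_left_cases:
  "proj_left u v = (if V1 \<notin> set v \<and> word_deg v = 0 then frag_of u
     else if V1 \<notin> set v \<and> word_deg v = 1 then contract True u
     else if word_deg v = 0 then collapse True u else 0)"
  by (auto simp: proj_left_def bottom_faces_def count_list_0_iff)

text \<open>Over an edge leaving the bottom vertex the chain map condition is the homotopy formula
  \<open>chain_diff_contract\<close>; over a square there the two contractions cancel.\<close>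

lemma strict_functor_proj_left:
  "strict_functor (lift_chain (split_word m proj_left)) (nat_cube (m + n)) (nat_cube m)"
proof (rule strict_functor_lift_split_word)
  fix u v :: "interval list" assume u: "length u = m" and "length v = n"
  show "cube_chain m (word_deg u + word_deg v) (proj_left u v)"
    using cube_chain_contract[of u True] u
    by (auto simp: proj_left_cases collapse_eq word_deg_vertex)
  have "frag_extend word_aug (contract True u) = 0"
    by (rule word_aug_pos_deg[OF cube_chain_contract zero_less_Suc])
  then show "frag_extend word_aug (proj_left u v) = (if Edge \<in> set u \<or> Edge \<in> set v then 0 else frag_of [])"
    by (auto simp: proj_left_cases collapse_eq word_aug_def count_list_0_iff)
  \<comment> \<open>\<open>collapse True u\<close> is nonzero only in degree 0, where the sign is
    one.\<close>
  have s: "frag_cmul (word_sign u) (collapse True u) = collapse True u"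
    by (simp add: collapse_eq word_deg_vertex)
  \<comment> \<open>Of the three summands only the one at the bottom vertex survives the
    differential of the right factor.\<close>
  have 1: "frag_extend (proj_left u) (word_diff v) = - bottom_faces 1 (frag_of u - collapse True u) v"
    unfolding proj_left_def frag_extend_fun_add
    by (simp add: word_diff_vertex_faces bottom_faces_0_diff bottom_faces_1_diff[unfolded One_nat_def])
  have 2: "frag_extend (\<lambda>u. proj_left u v) (word_diff u) =
    bottom_faces 0 (word_diff u) v + bottom_faces 1 (frag_extend (contract True) (word_diff u)) v"
    unfolding proj_left_def frag_extend_fun_add
    by (cases "Edge \<in> set v") (auto simp: bottom_faces_def frag_extend_fun_diff frag_extend_frag_of collapse_word_diff frag_extend_fun_zero)
  show "chain_diff (proj_left u v) = frag_extend (\<lambda>u. proj_left u v) (word_diff u)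
      + frag_cmul (word_sign u) (frag_extend (proj_left u) (word_diff v))"
    unfolding 1 2
    by (auto simp: proj_left_def frag_extend_add bottom_faces_def frag_extend_diff chain_diff_collapse 
      chain_diff_contract frag_cmul_diff2 s)
qed

lemma strict_functor_incl_left:
  "strict_functor (lift_chain (\<lambda>w. frag_of (w @ replicate n V0))) (nat_cube m) (nat_cube (m + n))"
  by (rule strict_functor_lift_chain) (auto simp: word_diff_append word_diff_vertex word_aug_def word_deg_vertex)

lemma strict_functor_incl_right:
  "strict_functor (lift_chain (\<lambda>w. frag_of (replicate m V1 @ w))) (nat_cube n) (nat_cube (m + n))"
  by (rule strict_functor_lift_chain) (auto simp: word_diff_append word_diff_vertex word_aug_def word_deg_vertex)

section \<open>Retracts and wedge sums\<close>

lemma strict_functorD: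
  assumes "strict_functor F C D"
  shows "x \<in> cells C \<Longrightarrow> F x \<in> cells D"
    and "x \<in> cells C \<Longrightarrow> F (bd C s n x) = bd D s n (F x)"
    and "x \<in> cells C \<Longrightarrow> y \<in> cells C \<Longrightarrow> tgt C n x = src C n y \<Longrightarrow> F (gcomp C n x y) = gcomp D n (F x) (F y)"
    and "x \<in> cells C \<Longrightarrow> y \<in> cells C \<Longrightarrow> tgt C n x = src C n y \<Longrightarrow> tgt D n (F x) = src D n (F y)"
  using assms unfolding strict_functor_def by metis+

lemma strict_functor_comp:
  assumes "strict_functor F C D" "strict_functor G D E"
  shows "strict_functor (\<lambda>x. G (F x)) C E"
  using assms unfolding strict_functor_def by metis

lemma strict_functor_id: "strict_functor (\<lambda>x. x) C C"
  by (simp add: strict_functor_def)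

lemma bip_retract_trans:
  assumes "bip_retract X Y" "bip_retract Y Z"
  shows "bip_retract X Z"
proof -
  obtain i r where ir: "bip_functor i X Y" "bip_functor r Y X" "\<forall>x\<in>cells X. r (i x) = x"
    using assms(1) unfolding bip_retract_def by blast
  obtain j q where jq: "bip_functor j Y Z" "bip_functor q Z Y" "\<forall>x\<in>cells Y. q (j x) = x"
    using assms(2) unfolding bip_retract_def by blast
  have "bip_functor (\<lambda>x. j (i x)) X Z" "bip_functor (\<lambda>x. r (q x)) Z X"
    using ir jq by (auto simp: bip_functor_def intro: strict_functor_comp)
  moreover have "\<forall>x\<in>cells X. r (q (j (i x))) = x"
    using ir jq by (simp add: bip_functor_def strict_functor_def)
  ultimately show ?thesis unfolding bip_retract_def by blast
qed

lemma object_bd: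
  assumes "omega_category C" "x \<in> objects C"
  shows "x \<in> cells C" "bd C s n x = x"
  using assms(2) omega_category.bd_bd_ge[OF assms(1), of x 0 n s False] by (auto simp: objects_def)

section \<open>Wedge sums through their universal property\<close>

definition wedge_inl :: "'a bip_omega \<Rightarrow> 'b bip_omega \<Rightarrow> 'a \<Rightarrow> ('a, 'b) po_term set" where
  "wedge_inl C D x = po_class terminal_omega (\<lambda>_. pt1 C) (\<lambda>_. pt0 D) C D (InL x)"

definition wedge_inr :: "'a bip_omega \<Rightarrow> 'b bip_omega \<Rightarrow> 'b \<Rightarrow> ('a, 'b) po_term set" where
  "wedge_inr C D y = po_class terminal_omega (\<lambda>_. pt1 C) (\<lambda>_. pt0 D) C D (InR y)"

lemma wedge_pts: "pt0 (wedge C D) = wedge_inl C D (pt0 C)" "pt1 (wedge C D) = wedge_inr C D (pt1 D)"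
  by (simp_all add: wedge_def Let_def wedge_inl_def wedge_inr_def)

lemma strict_functor_to_bipoint: "strict_functor F C (bipoint D a b) \<longleftrightarrow> strict_functor F C D"
  by (simp add: strict_functor_def)

lemma strict_functor_from_bipoint: "strict_functor F (bipoint C a b) D \<longleftrightarrow> strict_functor F C D"
  by (simp add: strict_functor_def)

lemma wedge_square:
  shows "strict_functor (wedge_inl C D) C (wedge C D)" "strict_functor (wedge_inr C D) D (wedge C D)"
    and "wedge_inl C D (pt1 C) = wedge_inr C D (pt0 D)"
  unfolding wedge_def Let_def strict_functor_to_bipoint wedge_inl_def wedge_inr_def
  using pushout_square(1)[of terminal_omega "\<lambda>_. pt1 C" "\<lambda>_. pt0 D" C D]
    pushout_square(2)[of terminal_omega "\<lambda>_. pt1 C" "\<lambda>_. pt0 D" C D]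
    pushout_square(3)[of "()" terminal_omega "\<lambda>_. pt1 C" "\<lambda>_. pt0 D" C D]
  by (simp_all add: terminal_omega_def)

lemma wedge_universal:
  assumes "bipointed C" "omega_category Z" "strict_functor h C Z" "strict_functor k D Z" "h (pt1 C) = k (pt0 D)"
  obtains \<phi> where "strict_functor \<phi> (wedge C D) Z" "\<And>x. x \<in> cells C \<Longrightarrow> \<phi> (wedge_inl C D x) = h x"
    "\<And>y. y \<in> cells D \<Longrightarrow> \<phi> (wedge_inr C D y) = k y"
proof -
  have "(\<lambda>_. pt1 C) ` cells terminal_omega \<subseteq> cells C"
    using assms(1) by (auto simp: bipointed_def objects_def)
  from pushout_universal[OF assms(2-4) _ this, of "\<lambda>_. pt0 D"] assms(5) that show ?thesis
    by (auto simp: wedge_def wedge_inl_def wedge_inr_def Let_def strict_functor_from_bipoint)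
qed

lemma wedge_unique:
  assumes "bipointed C" "bipointed D" "strict_functor \<phi> (wedge C D) Z" "strict_functor \<psi> (wedge C D) Z"
    and "\<And>x. x \<in> cells C \<Longrightarrow> \<phi> (wedge_inl C D x) = \<psi> (wedge_inl C D x)"
    and "\<And>y. y \<in> cells D \<Longrightarrow> \<phi> (wedge_inr C D y) = \<psi> (wedge_inr C D y)"
    and "w \<in> cells (wedge C D)"
  shows "\<phi> w = \<psi> w"
proof (rule pushout_unique)
  show "omega_category C" "omega_category D" "(\<lambda>_. pt1 C) ` cells terminal_omega \<subseteq> cells C"
    "(\<lambda>_. pt0 D) ` cells terminal_omega \<subseteq> cells D"
    using assms(1,2) by (auto simp: bipointed_def objects_def)
qed (use assms(3-) in \<open>auto simp: wedge_def wedge_inl_def wedge_inr_def Let_def strict_functor_from_bipoint\<close>)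

text \<open>Preservation of the points makes the functors on the two summands agree at the gluing
  point; the retraction identity is checked on the summands by \<open>wedge_unique\<close>.\<close>

lemma bip_retract_wedge:
  assumes "bipointed C" "bipointed D" "bipointed C'" "bipointed D'"
    and "bip_retract C C'" "bip_retract D D'"
  shows "bip_retract (wedge C D) (wedge C' D')"
proof -
  obtain i r where ir: "bip_functor i C C'" "bip_functor r C' C" "\<And>x. x \<in> cells C \<Longrightarrow> r (i x) = x"
    using assms(5) unfolding bip_retract_def by blast
  obtain j q where jq: "bip_functor j D D'" "bip_functor q D' D" "\<And>x. x \<in> cells D \<Longrightarrow> q (j x) = x"
    using assms(6) unfolding bip_retract_def by blast
  have pts: "pt0 C \<in> cells C" "pt1 D \<in> cells D" "pt0 C' \<in> cells C'" "pt1 D' \<in> cells D'"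
    using assms(1-4) by (auto simp: bipointed_def objects_def)
  have W: "omega_category (wedge C D)" and W': "omega_category (wedge C' D')"
    using assms(1-4) wedge_bipointed by (auto simp: bipointed_def)
  obtain \<phi> where \<phi>: "strict_functor \<phi> (wedge C D) (wedge C' D')"
      "\<And>x. x \<in> cells C \<Longrightarrow> \<phi> (wedge_inl C D x) = wedge_inl C' D' (i x)"
      "\<And>y. y \<in> cells D \<Longrightarrow> \<phi> (wedge_inr C D y) = wedge_inr C' D' (j y)"
  proof (rule wedge_universal[OF assms(1) W'])
    show "strict_functor (\<lambda>x. wedge_inl C' D' (i x)) C (wedge C' D')"
      "strict_functor (\<lambda>y. wedge_inr C' D' (j y)) D (wedge C' D')"
      using ir(1) jq(1) by (auto simp: bip_functor_def intro: strict_functor_comp wedge_square)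
    show "wedge_inl C' D' (i (pt1 C)) = wedge_inr C' D' (j (pt0 D))"
      using ir(1) jq(1) by (simp add: bip_functor_def wedge_square)
  qed blast
  obtain \<psi> where \<psi>: "strict_functor \<psi> (wedge C' D') (wedge C D)"
      "\<And>x. x \<in> cells C' \<Longrightarrow> \<psi> (wedge_inl C' D' x) = wedge_inl C D (r x)"
      "\<And>y. y \<in> cells D' \<Longrightarrow> \<psi> (wedge_inr C' D' y) = wedge_inr C D (q y)"
  proof (rule wedge_universal[OF assms(3) W])
    show "strict_functor (\<lambda>x. wedge_inl C D (r x)) C' (wedge C D)"
      "strict_functor (\<lambda>y. wedge_inr C D (q y)) D' (wedge C D)"
      using ir(2) jq(2) by (auto simp: bip_functor_def intro: strict_functor_comp wedge_square)
    show "wedge_inl C D (r (pt1 C')) = wedge_inr C D (q (pt0 D'))"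
      using ir(2) jq(2) by (simp add: bip_functor_def wedge_square)
  qed blast
  have ij: "i x \<in> cells C'" "j y \<in> cells D'" if "x \<in> cells C" "y \<in> cells D" for x y
    using that ir(1) jq(1) by (auto simp: bip_functor_def strict_functor_def)
  have "bip_functor \<phi> (wedge C D) (wedge C' D')"
    using \<phi> pts ir(1) jq(1) by (simp add: bip_functor_def wedge_pts)
  moreover have "bip_functor \<psi> (wedge C' D') (wedge C D)"
    using \<psi> pts ir(2) jq(2) by (simp add: bip_functor_def wedge_pts)
  moreover have "\<psi> (\<phi> w) = w" if "w \<in> cells (wedge C D)" for w
    using wedge_unique[OF assms(1,2) strict_functor_comp[OF \<phi>(1) \<psi>(1)] strict_functor_id _ _ that]
      \<phi>(2,3) \<psi>(2,3) ij ir(3) jq(3) pts by simp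
  ultimately show ?thesis unfolding bip_retract_def by blast
qed

text \<open>
  If nothing but the identity leaves the second point of \<open>C\<close> and nothing but the identity enters the
  first point of \<open>D\<close>, then the cells of \<open>C \<or> D\<close> can be described by pairs of a cell of \<open>C\<close> and a cell of \<open>D\<close>.
\<close>

definition wedge_pair :: "'a bip_omega \<Rightarrow> 'b bip_omega \<Rightarrow> 'a \<Rightarrow> 'b \<Rightarrow> ('a, 'b) po_term set" where
  "wedge_pair C D x y = (if y = pt0 D then wedge_inl C D x else if x = pt1 C then wedge_inr C D y
     else gcomp (wedge C D) 0 (wedge_inl C D x) (wedge_inr C D y))"

text \<open>By \<open>terminal\<close>, in a 0-composite no nontrivial cell of \<open>C\<close>
  follows a nontrivial cell of \<open>D\<close>. In higher dimensions \<open>terminal\<close> and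
  \<open>initial\<close> put both factors in the same case of \<open>wedge_pair\<close>, and
  interchange applies.\<close>

lemma strict_functor_wedge_pair:
  assumes C: "bipointed C" and D: "bipointed D"
    and terminal: "\<And>x. x \<in> cells C \<Longrightarrow> src C 0 x = pt1 C \<Longrightarrow> x = pt1 C"
    and initial: "\<And>y. y \<in> cells D \<Longrightarrow> tgt D 0 y = pt0 D \<Longrightarrow> y = pt0 D"
    and G: "strict_functor G Z C" and P: "strict_functor P Z D"
    and pair: "\<And>z. z \<in> cells Z \<Longrightarrow>
      P z = pt0 D \<or> G z = pt1 C \<or> (tgt C 0 (G z) = pt1 C \<and> src D 0 (P z) = pt0 D)"
  shows "strict_functor (\<lambda>z. wedge_pair C D (G z) (P z)) Z (wedge C D)"
proof -
  interpret C: omega_category C using C by (simp add: bipointed_def)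
  interpret D: omega_category D using D by (simp add: bipointed_def)
  interpret W: omega_category "wedge C D" using wedge_bipointed[OF C D] by (simp add: bipointed_def)
  let ?W = "wedge C D" and ?L = "wedge_inl C D" and ?R = "wedge_inr C D" and ?F = "wedge_pair C D"
  have pC: "pt1 C \<in> cells C" "bd C s n (pt1 C) = pt1 C" for s n
    using object_bd[of C "pt1 C"] C by (auto simp: bipointed_def)
  have pD: "pt0 D \<in> cells D" "bd D s n (pt0 D) = pt0 D" for s n
    using object_bd[of D "pt0 D"] D by (auto simp: bipointed_def)
  have cC: "gcomp C n (pt1 C) (pt1 C) = pt1 C" for n using C.unit_left[OF pC(1), of n] pC(2) by simp
  have cD: "gcomp D n (pt0 D) (pt0 D) = pt0 D" for n using D.unit_left[OF pD(1), of n] pD(2) by simp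
  note L = strict_functorD[OF wedge_square(1)[of C D]] and R = strict_functorD[OF wedge_square(2)[of C D]]
  have LR: "tgt ?W 0 (?L x) = src ?W 0 (?R y)"
    if "x \<in> cells C" "y \<in> cells D" "tgt C 0 x = pt1 C" "src D 0 y = pt0 D" for x y
    using that wedge_square(3)[of C D] by (metis L(2) R(2))
  have FL: "?F x (pt0 D) = ?L x" for x by (simp add: wedge_pair_def)
  have FR: "?F (pt1 C) y = ?R y" for y by (simp add: wedge_pair_def wedge_square(3))
  \<comment> \<open>The cases of \<open>wedge_pair\<close> overlap harmlessly: a base point acts as
    a unit, so the composite is the value wherever it is defined.\<close>
  have FC: "?F x y = gcomp ?W 0 (?L x) (?R y)"
    if "x \<in> cells C" "y \<in> cells D" "tgt C 0 x = pt1 C" "src D 0 y = pt0 D" for x y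
  proof (cases "y = pt0 D")
    case True
    then have "?R y = tgt ?W 0 (?L x)" using that wedge_square(3)[of C D] by (metis L(2))
    then show ?thesis using W.unit_right[OF L(1)[OF that(1)], of 0] True by (simp add: FL)
  next
    case False
    show ?thesis
    proof (cases "x = pt1 C")
      case True
      then have "?L x = src ?W 0 (?R y)" using that wedge_square(3)[of C D] by (metis R(2))
      then show ?thesis using W.unit_left[OF R(1)[OF that(2)], of 0] True by (simp add: FR)
    qed (use False in \<open>simp add: wedge_pair_def\<close>)
  qed
  have Z: "G z \<in> cells C" "P z \<in> cells D" if "z \<in> cells Z" for z
    using that strict_functorD(1)[OF G] strict_functorD(1)[OF P] by auto
  have cell: "?F x y \<in> cells ?W"
    if "x \<in> cells C" "y \<in> cells D"
      "y = pt0 D \<or> x = pt1 C \<or> (tgt C 0 x = pt1 C \<and> src D 0 y = pt0 D)" for x y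
    using that(3)
  proof (elim disjE conjE)
    assume "tgt C 0 x = pt1 C" "src D 0 y = pt0 D"
    then show ?thesis using that(1,2) by (simp add: FC LR L(1) R(1) W.comp_closed)
  qed (use that in \<open>simp_all add: FL FR L(1) R(1)\<close>)
  have bd: "?F (bd C s n x) (bd D s n y) = bd ?W s n (?F x y)"
    if x: "x \<in> cells C" and y: "y \<in> cells D"
      and xy: "y = pt0 D \<or> x = pt1 C \<or> (tgt C 0 x = pt1 C \<and> src D 0 y = pt0 D)" for x y s n
    using xy
  proof (elim disjE conjE)
    assume a: "tgt C 0 x = pt1 C" "src D 0 y = pt0 D"
    note F = FC[OF x y a] and c = LR[OF x y a]
    show ?thesis
    proof (cases "n = 0")
      case True
      then show ?thesis
        using a F c x y W.src_comp[OF L(1)[OF x] R(1)[OF y] c] W.tgt_comp[OF L(1)[OF x] R(1)[OF y] c]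
        by (cases s) (simp_all add: FL FR L(2) R(2))
    next
      case False
      then have "tgt C 0 (bd C s n x) = pt1 C" "src D 0 (bd D s n y) = pt0 D"
        using a x y by (simp_all add: C.bd_bd_less D.bd_bd_less)
      then show ?thesis
        using False x y F W.bd_comp_greater[OF L(1)[OF x] R(1)[OF y] c, of n s]
        by (simp add: FC C.bd_closed D.bd_closed L(2) R(2))
    qed
  qed (use x y in \<open>simp_all add: FL FR pC pD L(2) R(2)\<close>)
  have comp: "?F (gcomp C n x x') (gcomp D n y y') = gcomp ?W n (?F x y) (?F x' y')"
    if x: "x \<in> cells C" and y: "y \<in> cells D" and x': "x' \<in> cells C" and y': "y' \<in> cells D"
      and cx: "tgt C n x = src C n x'" and cy: "tgt D n y = src D n y'"
      and xy: "y = pt0 D \<or> x = pt1 C \<or> (tgt C 0 x = pt1 C \<and> src D 0 y = pt0 D)"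
      and xy': "y' = pt0 D \<or> x' = pt1 C \<or> (tgt C 0 x' = pt1 C \<and> src D 0 y' = pt0 D)" for x y x' y' n
  proof (cases "n = 0")
    case True
    note n0 = True
    note cx = cx[unfolded n0] and cy = cy[unfolded n0]
    note cL = L(4)[OF x x' cx] and cR = R(4)[OF y y' cy]
    have x'1: "x' = pt1 C" if "tgt C 0 x = pt1 C" using that cx terminal[OF x'] by simp
    from xy show ?thesis
    proof (elim disjE conjE)
      assume y0: "y = pt0 D"
      then have s0: "src D 0 y' = pt0 D" using cy pD(2) by simp
      show ?thesis
      proof (cases "y' = pt0 D")
        case True
        then show ?thesis using y0 x x' cx by (simp add: n0 cD FL L(3))
      next
        case False
        \<comment> \<open>Since \<open>y'\<close> is not the base point, each remaining case of
          \<open>xy'\<close> puts the end of \<open>x'\<close> at the gluing point.\<close>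
        then have t: "tgt C 0 x' = pt1 C" using xy' pC(2) by auto
        have "gcomp D 0 y y' = y'" using D.unit_left[OF y', of 0] s0 y0 by simp
        moreover have "tgt C 0 (gcomp C 0 x x') = pt1 C" using C.tgt_comp[OF x x' cx] t by simp
        ultimately show ?thesis
          using y0 s0 t x x' y' C.comp_closed[OF x x' cx]
            W.assoc[OF L(1)[OF x] L(1)[OF x'] R(1)[OF y'] cL LR[OF x' y' t s0]]
          by (simp add: n0 FC FL L(3)[OF x x' cx])
      qed
    next
      assume x1: "x = pt1 C"
      then have "x' = pt1 C" using x'1 pC(2) by simp
      then show ?thesis using x1 by (simp add: n0 cC FR R(3)[OF y y' cy])
    next
      assume a: "tgt C 0 x = pt1 C" "src D 0 y = pt0 D"
      note x'1 = x'1[OF a(1)]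
      have "gcomp C 0 x x' = x" using C.unit_right[OF x, of 0] a x'1 by simp
      moreover have "src D 0 (gcomp D 0 y y') = pt0 D" using D.src_comp[OF y y' cy] a by simp
      ultimately show ?thesis
        using a x'1 x y y' D.comp_closed[OF y y' cy]
          W.assoc[OF L(1)[OF x] R(1)[OF y] R(1)[OF y'] LR[OF x y a] cR]
        by (simp add: n0 FC FR R(3)[OF y y' cy])
    qed
  next
    case False
    then have n: "0 < n" by simp
    \<comment> \<open>Cells composable in positive dimension share their 0-dimensional
      boundaries.\<close>
    have bx: "bd C s 0 x = bd C s 0 x'" for s
      using C.bd_bd_less[OF x n, of s True] C.bd_bd_less[OF x' n, of s False] cx by simp
    have by': "bd D s 0 y = bd D s 0 y'" for s
      using D.bd_bd_less[OF y n, of s True] D.bd_bd_less[OF y' n, of s False] cy by simp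
    have y0: "y = pt0 D \<longleftrightarrow> y' = pt0 D"
      using by'[of True] initial[OF y] initial[OF y'] pD(2) by metis
    have x1: "x = pt1 C \<longleftrightarrow> x' = pt1 C"
      using bx[of False] terminal[OF x] terminal[OF x'] pC(2) by metis
    from xy show ?thesis
    proof (elim disjE conjE)
      assume "y = pt0 D" then show ?thesis using y0 by (simp add: cD FL L(3)[OF x x' cx])
    next
      assume "x = pt1 C" then show ?thesis using x1 by (simp add: cC FR R(3)[OF y y' cy])
    next
      assume a: "tgt C 0 x = pt1 C" "src D 0 y = pt0 D"
      then have a': "tgt C 0 x' = pt1 C" "src D 0 y' = pt0 D" using bx by' by auto
      have "tgt C 0 (gcomp C n x x') = pt1 C" "src D 0 (gcomp D n y y') = pt0 D"
        using a C.bd_comp_less[OF x x' cx n] D.bd_comp_less[OF y y' cy n] by simp_all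
      then have "?F (gcomp C n x x') (gcomp D n y y')
          = gcomp ?W 0 (gcomp ?W n (?L x) (?L x')) (gcomp ?W n (?R y) (?R y'))"
        using C.comp_closed[OF x x' cx] D.comp_closed[OF y y' cy]
        by (simp add: FC L(3)[OF x x' cx] R(3)[OF y y' cy])
      also have "\<dots> = gcomp ?W n (gcomp ?W 0 (?L x) (?R y)) (gcomp ?W 0 (?L x') (?R y'))"
        by (rule W.interchange[OF L(1)[OF x] L(1)[OF x'] R(1)[OF y] R(1)[OF y'] n
              L(4)[OF x x' cx] R(4)[OF y y' cy] LR[OF x y a] LR[OF x' y' a']])
      finally show ?thesis by (simp add: FC x y x' y' a a')
    qed
  qed
  show ?thesis
    unfolding strict_functor_def
  proof (intro conjI ballI allI impI)
    fix z assume z: "z \<in> cells Z"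
    show "?F (G z) (P z) \<in> cells ?W" by (rule cell[OF Z[OF z] pair[OF z]])
    show "?F (G (bd Z s n z)) (P (bd Z s n z)) = bd ?W s n (?F (G z) (P z))" for s n
      using bd[OF Z[OF z] pair[OF z]] z by (simp add: strict_functorD(2)[OF G] strict_functorD(2)[OF P])
    fix z' n assume z': "z' \<in> cells Z" and c: "tgt Z n z = src Z n z'"
    show "?F (G (gcomp Z n z z')) (P (gcomp Z n z z')) = gcomp ?W n (?F (G z) (P z)) (?F (G z') (P z'))"
      unfolding strict_functorD(3)[OF G z z' c] strict_functorD(3)[OF P z z' c]
      by (rule comp[OF Z[OF z] Z[OF z'] strict_functorD(4)[OF G z z' c] strict_functorD(4)[OF P z z' c]
            pair[OF z] pair[OF z']])
  qed
qed

section \<open>The wedge of two cubes as a retract of a cube\<close>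

lemma nat_cube_const:
  shows "x \<in> cells (nat_cube n) \<Longrightarrow> src (nat_cube n) 0 x = pt1 (nat_cube n) \<Longrightarrow> x = pt1 (nat_cube n)"
    and "x \<in> cells (nat_cube n) \<Longrightarrow> tgt (nat_cube n) 0 x = pt0 (nat_cube n) \<Longrightarrow> x = pt0 (nat_cube n)"
proof -
  have e: "x (\<not> s) 0 = frag_of w" if "bd (nat_cube n) (\<not> s) 0 x = nu_vertex w" for s w
    using fun_cong[OF fun_cong[OF that, of s], of 0] by (simp add: nat_cube_bd nu_vertex_def)
  show "x \<in> cells (nat_cube n) \<Longrightarrow> src (nat_cube n) 0 x = pt1 (nat_cube n) \<Longrightarrow> x = pt1 (nat_cube n)"
    using cube_cell_const[of x n True] e[of True "replicate n V1"] by (simp add: nat_cube_pt)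
  show "x \<in> cells (nat_cube n) \<Longrightarrow> tgt (nat_cube n) 0 x = pt0 (nat_cube n) \<Longrightarrow> x = pt0 (nat_cube n)"
    using cube_cell_const[of x n False] e[of False "replicate n V0"] by (simp add: nat_cube_pt)
qed

lemma cube_cell_vertexE:
  assumes "z \<in> cells (nat_cube n)"
  obtains w where "length w = n" "Edge \<notin> set w" "z s 0 = frag_of w"
  using cube_vertexE[OF nat_cube_cellsD(1,3)[OF assms]] .

lemma nat_cube_bd_0: 
  assumes "z s 0 = frag_of w"
  shows "bd (nat_cube n) s 0 z = nu_vertex w"
  using assms by (simp add: nat_cube_bd nu_vertex_def fun_eq_iff)

lemma lift_chain_lift_chain:
  assumes "z \<in> cells (nat_cube n)" "\<And>w. length w = n \<Longrightarrow> frag_extend g (f w) = frag_of w"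
  shows "lift_chain g (lift_chain f z) = z"
proof (intro ext)
  fix s i
  have "frag_extend (\<lambda>w. frag_extend g (f w)) (z s i) = frag_extend frag_of (z s i)"
    by (rule cube_chain_cong[OF nat_cube_cellsD(1)[OF assms(1)] assms(2)])
  then show "lift_chain g (lift_chain f z) s i = z s i"
    by (simp add: lift_chain_def frag_extend_frag_extend frag_extend_frag_of)
qed

lemma vertex_without_V1: "Edge \<notin> set w \<Longrightarrow> V1 \<notin> set w \<Longrightarrow> w = replicate (length w) V0"
  by (metis (full_types) interval.exhaust replicate_length_same)

lemma bip_retract_wedge_cubes:
  "bip_retract (wedge (nat_cube m) (nat_cube n)) (nat_cube (m + n))"
proof -
  let ?C = "nat_cube m" and ?D = "nat_cube n" and ?E = "nat_cube (m + n)"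
  let ?G = "lift_chain (split_word m proj_left)" and ?P = "lift_chain (split_word m proj_right)"
  let ?i = "lift_chain (\<lambda>w. frag_of (w @ replicate n V0))" and ?j = "lift_chain (\<lambda>w. frag_of (replicate m V1 @ w))"
  let ?r = "\<lambda>z. wedge_pair ?C ?D (?G z) (?P z)"
  note G = strict_functor_proj_left[of m n] and P = strict_functor_proj_right[of m n]
  note Gc = strict_functorD(1)[OF G] and Pc = strict_functorD(1)[OF P]
  have pair: "?P z = pt0 ?D \<or> ?G z = pt1 ?C \<or> (tgt ?C 0 (?G z) = pt1 ?C \<and> src ?D 0 (?P z) = pt0 ?D)"
    if z: "z \<in> cells ?E" for z
  proof -
    \<comment> \<open>At a vertex \<open>u @ v\<close>, either \<open>v\<close> is the bottom
      vertex, or it has a letter \<open>V1\<close> and \<open>proj_left\<close> sends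
      \<open>u\<close> to the top vertex.\<close>
    have vert: "?P z s 0 = frag_of (replicate n V0) \<or> ?G z s 0 = frag_of (replicate m V1)" for s
    proof -
      obtain w where w: "length w = m + n" "Edge \<notin> set w" "z s 0 = frag_of w"
        using cube_cell_vertexE[OF z] .
      define u v where "u = take m w" and "v = drop m w"
      have uv: "w = u @ v" "length u = m" "length v = n" using w by (auto simp: u_def v_def)
      then show ?thesis
        using w vertex_without_V1[of v]
        by (auto simp: lift_chain_def proj_left_cases collapse_eq word_deg_vertex)
    qed
    \<comment> \<open>If \<open>?P z\<close> ends at the bottom or \<open>?G z\<close> starts at the
      top, that cell is constant. Otherwise \<open>?G z\<close> ends at the top and
      \<open>?P z\<close> starts at the bottom, as the gluing requires.\<close>
    from vert[of True] vert[of False] show ?thesis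
      using nat_cube_const[OF Gc[OF z]] nat_cube_const[OF Pc[OF z]] 
        nat_cube_bd_0[of "?P z" _ "replicate n V0" n] nat_cube_bd_0[of "?G z" _ "replicate m V1" m]
      by (auto simp: nat_cube_pt)
  qed
  have r: "strict_functor ?r ?E (wedge ?C ?D)"
    by (rule strict_functor_wedge_pair[OF nat_cube_bipointed nat_cube_bipointed nat_cube_const G P pair])
  have glue: "?i (pt1 ?C) = ?j (pt0 ?D)"
    by (simp add: nat_cube_pt lift_chain_vertex)
  obtain \<phi> where \<phi>: "strict_functor \<phi> (wedge ?C ?D) ?E"
      "\<And>x. x \<in> cells ?C \<Longrightarrow> \<phi> (wedge_inl ?C ?D x) = ?i x"
      "\<And>y. y \<in> cells ?D \<Longrightarrow> \<phi> (wedge_inr ?C ?D y) = ?j y"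
    using wedge_universal[where h = ?i and k = ?j, OF nat_cube_bipointed nat_cube_omega
        strict_functor_incl_left strict_functor_incl_right glue] by blast
  have ri: "?r (?i x) = wedge_inl ?C ?D x" if x: "x \<in> cells ?C" for x
  proof -
    have ix: "?i x \<in> cells ?E" by (rule strict_functorD(1)[OF strict_functor_incl_left x])
    obtain w where w: "length w = m" "Edge \<notin> set w" "x True 0 = frag_of w" using cube_cell_vertexE[OF x] .
    then have "?P (?i x) True 0 = frag_of (replicate n V0)" by (simp add: lift_chain_def)
    then have "?P (?i x) = pt0 ?D"
      using nat_cube_const(2)[OF Pc[OF ix]] nat_cube_bd_0 by (metis nat_cube_pt(1))
    moreover have "?G (?i x) = x"
      by (rule lift_chain_lift_chain[OF x]) (simp add: proj_left_cases word_deg_vertex)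
    ultimately show ?thesis by (simp add: wedge_pair_def)
  qed
  have rj: "?r (?j y) = wedge_inr ?C ?D y" if y: "y \<in> cells ?D" for y
  proof -
    have jy: "?j y \<in> cells ?E" by (rule strict_functorD(1)[OF strict_functor_incl_right y])
    obtain w where w: "length w = n" "Edge \<notin> set w" "y False 0 = frag_of w" using cube_cell_vertexE[OF y] .
    then have "?G (?j y) False 0 = frag_of (replicate m V1)"
      by (simp add: lift_chain_def proj_left_cases collapse_eq word_deg_vertex)
    then have "?G (?j y) = pt1 ?C"
      using nat_cube_const(1)[OF Gc[OF jy]] nat_cube_bd_0 by (metis nat_cube_pt(2))
    moreover have "?P (?j y) = y"
      by (rule lift_chain_lift_chain[OF y]) simp
    ultimately show ?thesis by (simp add: wedge_pair_def wedge_square(3))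
  qed
  have pts: "pt0 ?C \<in> cells ?C" "pt1 ?D \<in> cells ?D"
    using nat_cube_bipointed by (auto simp: bipointed_def objects_def)
  have ip: "?i (pt0 ?C) = pt0 ?E" "?j (pt1 ?D) = pt1 ?E"
    by (simp_all add: nat_cube_pt lift_chain_vertex replicate_add) (simp_all add: nu_vertex_def)
  have "bip_functor \<phi> (wedge ?C ?D) ?E"
    using \<phi> ip pts by (simp add: bip_functor_def wedge_pts)
  moreover have "bip_functor ?r ?E (wedge ?C ?D)"
    using r ri[OF pts(1)] rj[OF pts(2)] by (simp add: bip_functor_def wedge_pts ip)
  moreover have "?r (\<phi> w) = w" if "w \<in> cells (wedge ?C ?D)" for w
    by (rule wedge_unique[OF nat_cube_bipointed nat_cube_bipointed strict_functor_comp[OF \<phi>(1) r]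
          strict_functor_id _ _ that]) (simp_all add: \<phi>(2,3) ri rj)
  ultimately show ?thesis unfolding bip_retract_def by blast
qed

section \<open>Suspensions\<close>

lemma suspension_simps [simp]:
  "cells (suspension C) = {Susp0, Susp1} \<union> SuspCell ` cells C" "bd (suspension C) = susp_bd C"
  "gcomp (suspension C) = susp_comp C" "pt0 (suspension C) = Susp0" "pt1 (suspension C) = Susp1"
  by (simp_all add: suspension_def)

lemma strict_functor_map_susp_cell:
  assumes "strict_functor F C D"
  shows "strict_functor (map_susp_cell F) (suspension C) (suspension D)"
  unfolding strict_functor_def
proof (intro conjI ballI allI impI)
  note F = strict_functorD[OF assms]
  fix x assume x: "x \<in> cells (suspension C)"
  show "map_susp_cell F x \<in> cells (suspension D)" using x F(1) by auto
  show "map_susp_cell F (bd (suspension C) s n x) = bd (suspension D) s n (map_susp_cell F x)" for s n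
    using x F(2) by (cases x; cases n) auto
  fix y n assume "y \<in> cells (suspension C)" "tgt (suspension C) n x = src (suspension C) n y"
  then show "map_susp_cell F (gcomp (suspension C) n x y)
      = gcomp (suspension D) n (map_susp_cell F x) (map_susp_cell F y)"
    using x F(3) by (cases x; cases y; cases n) auto
qed

lemma bip_retract_suspension:
  fixes X :: "'a bip_omega" and Y :: "'b bip_omega"
  assumes "bip_retract X Y"
  shows "bip_retract (suspension X) (suspension Y)"
proof -
  obtain i r where ir: "bip_functor i X Y" "bip_functor r Y X" "\<forall>x\<in>cells X. r (i x) = x"
    using assms unfolding bip_retract_def by blast
  then have "bip_functor (map_susp_cell i) (suspension X) (suspension Y)"
    "bip_functor (map_susp_cell r) (suspension Y) (suspension X)"
    by (simp_all add: bip_functor_def strict_functor_map_susp_cell)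
  moreover have "\<forall>x\<in>cells (suspension X). map_susp_cell r (map_susp_cell i x) = x"
    using ir(3) by auto
  ultimately show ?thesis unfolding bip_retract_def by blast
qed

section \<open>Embedding and quotient map of the suspension on chains\<close>

lemma word_diff_snoc:
  "word_diff (w @ [x]) = lin_app (word_diff w) [x]
     + (if x = Edge then frag_cmul (word_sign w) (frag_of (w @ [V1]) - frag_of (w @ [V0])) else 0)"
  by (simp add: word_diff_append frag_linear)

text \<open>
  A cell of the cube is sent to its product with the last edge, joined to the initial vertex by its
  contraction in the bottom face and to the final vertex by its contraction in the top face.
\<close>

definition susp_in :: "interval list \<Rightarrow> (interval list \<Rightarrow>\<^sub>0 int)" where
  "susp_in w = lin_app (contract False w) [V0] + frag_of (w @ [Edge]) + lin_app (contract True w) [V1]"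

lemma cube_chain_susp_in: "cube_chain (Suc (length w)) (Suc (word_deg w)) (susp_in w)"
proof -
  have "cube_chain (Suc (length w)) (Suc (word_deg w)) (lin_app (contract s w) [endpoint s])" for s
    by (rule cube_chain_frag_extend[OF cube_chain_contract]) auto
  from this[of True] this[of False] show ?thesis
    unfolding susp_in_def by (intro cube_chain_add) auto
qed

lemma chain_diff_lin_snoc:
  "x \<noteq> Edge \<Longrightarrow> chain_diff (lin_app c [x]) = lin_app (chain_diff c) [x]"
  by (simp add: frag_extend_frag_extend word_diff_snoc)

text \<open>The copies of \<open>w\<close> in the end faces cancel against the ends of
  \<open>w @ [Edge]\<close>. The collapse terms left over give the difference of the end vertices if
  \<open>w\<close> is a vertex and vanish otherwise.\<close>

lemma chain_diff_susp_in:
  "chain_diff (susp_in w) = frag_extend susp_in (word_diff w)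
     + (lin_app (collapse True w) [V1] - lin_app (collapse False w) [V0])"
proof -
  have "frag_extend susp_in c = lin_app (frag_extend (contract False) c) [V0] + lin_app c [Edge]
      + lin_app (frag_extend (contract True) c) [V1]" for c
    unfolding susp_in_def[abs_def] by (simp add: frag_extend_fun_add frag_extend_frag_extend)
  then show ?thesis
    by (simp add: susp_in_def frag_extend_add chain_diff_lin_snoc chain_diff_contract word_diff_snoc
      frag_extend_cmul frag_extend_diff frag_cmul_diff2 frag_extend_minus
      algebra_simps flip: minus_frag_cmul)
qed

abbreviation edge_part :: "interval list \<Rightarrow> interval list \<Rightarrow> (interval list \<Rightarrow>\<^sub>0 int)" where
  "edge_part u v \<equiv> (if v = [Edge] then frag_of u else 0)"

text \<open>The quotient map keeps the part along the last edge and kills the end faces. It lowers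
  the degree by one, as \<open>susp_in\<close> raises it.\<close>

definition susp_out :: "nat \<Rightarrow> interval list \<Rightarrow> (interval list \<Rightarrow>\<^sub>0 int)" where
  "susp_out n = split_word n edge_part"

lemma word_snocE: 
  assumes "length w = Suc n"
  obtains u x where "w = u @ [x]" "length u = n"
  using assms by (metis append_butlast_last_id length_butlast diff_Suc_1 list.size(3) nat.distinct(1))

lemma susp_out_snoc [simp]: "length u = n \<Longrightarrow> susp_out n (u @ [x]) = (if x = Edge then frag_of u else 0)"
  by (simp add: susp_out_def)

lemma susp_out_susp_in:
  assumes "length w = n"
  shows "frag_extend (susp_out n) (susp_in w) = frag_of w"
proof -
  have "frag_extend (\<lambda>u. susp_out n (u @ [endpoint s])) (contract s w) = 0" for s
    using cube_chain_contract[of w s] assms by (intro frag_extend_eq_0) (auto simp: cube_chain_def)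
  from this[of True] this[of False] show ?thesis
    using assms by (simp add: susp_in_def frag_extend_add frag_extend_frag_extend)
qed

text \<open>The edge is the last letter, so the Leibniz sign affects only its two ends, which are
  killed; the shift of degree brings no sign.\<close>

lemma chain_diff_susp_out:
  assumes "length w = Suc n"
  shows "chain_diff (susp_out n w) = frag_extend (susp_out n) (word_diff w)"
proof -
  obtain u x where w: "w = u @ [x]" "length u = n" using word_snocE[OF assms] .
  have "frag_extend (\<lambda>u. edge_part u v) c = (if v = [Edge] then c else 0)" for v c
    by (simp add: frag_extend_frag_of frag_extend_fun_zero)
  moreover have "frag_extend (edge_part u) (word_diff [x]) = 0"
    by (simp add: frag_extend_diff)
  ultimately show ?thesis
    using split_word_diff[OF w(2), of edge_part "[x]"] w
    by (simp add: susp_out_def frag_extend_frag_of frag_extend_fun_zero del: word_diff.simps)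
qed

lemma cube_chain_susp_out:
  assumes "length w = Suc n" "word_deg w = Suc i"
  shows "cube_chain n i (susp_out n w)"
proof -
  obtain u x where w: "w = u @ [x]" "length u = n" using word_snocE[OF assms(1)] .
  then show ?thesis using assms by auto
qed

lemma cube_chain_aug_eq_0:
  assumes "cube_chain n 0 c" "frag_extend word_aug c = 0"
  shows "c = 0"
proof -
  have "(\<Sum>w\<in>Poly_Mapping.keys c. Poly_Mapping.lookup c w) = 0"
    using lookup_word_aug[OF assms(1)] assms(2) by simp
  then have "Poly_Mapping.lookup c w = 0" if "w \<in> Poly_Mapping.keys c" for w
    using assms(1) that sum_nonneg_eq_0_iff[of "Poly_Mapping.keys c" "Poly_Mapping.lookup c"]
    by (auto simp: cube_chain_def)
  then show ?thesis by (intro poly_mapping_eqI) (metis in_keys_iff lookup_zero)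
qed

abbreviation last_coord :: "nat \<Rightarrow> (bool \<Rightarrow> nat \<Rightarrow> (interval list \<Rightarrow>\<^sub>0 int)) \<Rightarrow> (bool \<Rightarrow> nat \<Rightarrow> (interval list \<Rightarrow>\<^sub>0 int))" where
  "last_coord n \<equiv> lift_chain (split_word n proj_right)"

abbreviation susp_out_cell :: "nat \<Rightarrow> (bool \<Rightarrow> nat \<Rightarrow> (interval list \<Rightarrow>\<^sub>0 int)) \<Rightarrow> (bool \<Rightarrow> nat \<Rightarrow> (interval list \<Rightarrow>\<^sub>0 int))" where
  "susp_out_cell n z \<equiv> (\<lambda>s i. frag_extend (susp_out n) (z s (Suc i)))"

text \<open>Each test needs one end of the last coordinate: a cell of the interval ending at
  \<open>V0\<close> or starting at \<open>V1\<close> is constant by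
  \<open>cube_cell_const\<close>.\<close>

definition susp_proj :: "nat \<Rightarrow> (bool \<Rightarrow> nat \<Rightarrow> (interval list \<Rightarrow>\<^sub>0 int)) \<Rightarrow> (bool \<Rightarrow> nat \<Rightarrow> (interval list \<Rightarrow>\<^sub>0 int)) susp_cell" where
  "susp_proj n z = (if last_coord n z True 0 = frag_of [V0] then Susp0
     else if last_coord n z False 0 = frag_of [V1] then Susp1 else SuspCell (susp_out_cell n z))"

text \<open>In degree one, \<open>u @ [Edge]\<close> has a vertex for \<open>u\<close>, so counting
  edges of the last coordinate is taking the augmentation of the part along it.\<close>

lemma last_coord_edge:
  assumes "cube_chain (Suc n) (Suc 0) c"
  shows "frag_extend (split_word n proj_right) c
    = lin_cons Edge (frag_extend word_aug (frag_extend (susp_out n) c))"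
  unfolding frag_extend_frag_extend
proof (rule cube_chain_cong[OF assms])
  fix w :: "interval list" assume w: "length w = Suc n" "word_deg w = Suc 0"
  obtain u x where wu: "w = u @ [x]" "length u = n" using word_snocE[OF w(1)] .
  then show "split_word n proj_right w = frag_extend (\<lambda>a. lin_cons Edge (word_aug a)) (susp_out n w)"
    using w by (cases "Edge \<in> set u") (auto simp: word_aug_def word_deg_vertex split: if_splits)
qed

lemma susp_out_cell_diff:
  assumes z: "z \<in> cells (nat_cube (Suc n))"
  shows "chain_diff (susp_out_cell n z s (Suc i)) = susp_out_cell n z True i - susp_out_cell n z False i"
    and "cube_chain n i (susp_out_cell n z s i)"
proof -
  have "chain_diff (susp_out_cell n z s (Suc i)) = frag_extend (susp_out n) (chain_diff (z s (Suc (Suc i))))"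
    unfolding frag_extend_frag_extend
    by (rule cube_chain_cong[OF nat_cube_cellsD(1)[OF z] chain_diff_susp_out])
  then show "chain_diff (susp_out_cell n z s (Suc i)) = susp_out_cell n z True i - susp_out_cell n z False i"
    by (simp add: nat_cube_cellsD(2)[OF z] frag_extend_diff)
  show "cube_chain n i (susp_out_cell n z s i)"
    by (rule cube_chain_frag_extend[OF nat_cube_cellsD(1)[OF z] cube_chain_susp_out])
qed

text \<open>If the last coordinate is constant, the part along the edge begins with a positive chain
  of augmentation zero, hence with zero, and continues with positive cycles.\<close>

lemma susp_proj_cases:
  assumes z: "z \<in> cells (nat_cube (Suc n))"
  obtains (bot) "\<And>s. last_coord n z s 0 = frag_of [V0]" "susp_proj n z = Susp0" "\<And>s i. susp_out_cell n z s i = 0"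
  | (top) "\<And>s. last_coord n z s 0 = frag_of [V1]" "susp_proj n z = Susp1" "\<And>s i. susp_out_cell n z s i = 0"
  | (cell) "\<And>s. last_coord n z s 0 = frag_of [endpoint s]" "susp_proj n z = SuspCell (susp_out_cell n z)"
     "susp_out_cell n z \<in> cells (nat_cube n)"
proof -
  let ?q = "last_coord n z"
  have q: "?q \<in> cells (nat_cube 1)"
    using strict_functorD(1)[OF strict_functor_proj_right[of n 1]] z by simp
  have edge: "?q s 1 = lin_cons Edge (frag_extend word_aug (susp_out_cell n z s 0))" for s
    using last_coord_edge[OF nat_cube_cellsD(1)[OF z]] by (simp add: lift_chain_def)
  have zero: "susp_out_cell n z s i = 0" if "\<And>s. ?q s 1 = 0" for s i
  proof (induction i arbitrary: s)
    case 0
    \<comment> \<open>\<open>tl\<close> removes the letter \<open>Edge\<close> again and so recovers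
      the augmentation from the edge component of \<open>?q\<close>.\<close>
    have "frag_extend word_aug (susp_out_cell n z s 0)
      = frag_extend (\<lambda>w. frag_of (tl w)) (lin_cons Edge (frag_extend word_aug (susp_out_cell n z s 0)))"
      by (simp add: frag_extend_frag_extend frag_extend_frag_of)
    then show ?case
      using that[of s] unfolding edge by (intro cube_chain_aug_eq_0[OF susp_out_cell_diff(2)[OF z]]) simp
  next
    case (Suc i)
    then have "chain_diff (susp_out_cell n z s (Suc i)) = 0" using susp_out_cell_diff(1)[OF z] by simp
    then show ?case by (rule positive_cycle_eq_0[OF susp_out_cell_diff(2)[OF z] zero_less_Suc])
  qed
  have vert: "?q s 0 = frag_of [V0] \<or> ?q s 0 = frag_of [V1]" for s
  proof -
    obtain w where w: "length w = 1" "Edge \<notin> set w" "?q s 0 = frag_of w" using cube_cell_vertexE[OF q] .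
    then obtain x where "w = [x]" "x \<noteq> Edge" by (cases w) auto
    then show ?thesis using w by (cases x) auto
  qed
  have ne: "frag_of [V0] \<noteq> frag_of [V1]" by (simp add: frag_of_eq)
  consider "?q True 0 = frag_of [V0]" | "?q False 0 = frag_of [V1]" | "?q True 0 = frag_of [V1]" "?q False 0 = frag_of [V0]"
    using vert[of True] vert[of False] by blast
  then show thesis
  proof cases
    case 1
    have q0: "?q = nu_vertex [V0]" using cube_cell_const[OF q, of False] 1 by simp
    show thesis
    proof (rule bot)
      show "?q s 0 = frag_of [V0]" for s by (simp add: q0 nu_vertex_def)
      show "susp_out_cell n z s i = 0" for s i by (rule zero) (simp add: q0 nu_vertex_def)
      show "susp_proj n z = Susp0" by (simp add: susp_proj_def 1)
    qed
  next
    case 2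
    have q1: "?q = nu_vertex [V1]" using cube_cell_const[OF q, of True] 2 by simp
    show thesis
    proof (rule top)
      show "?q s 0 = frag_of [V1]" for s by (simp add: q1 nu_vertex_def)
      show "susp_out_cell n z s i = 0" for s i by (rule zero) (simp add: q1 nu_vertex_def)
      show "susp_proj n z = Susp1" using ne by (simp add: susp_proj_def q1 nu_vertex_def)
    qed
  next
    case 3
    then have 3: "?q s 0 = frag_of [endpoint s]" for s by (cases s) simp_all
    have aug: "frag_extend word_aug (susp_out_cell n z s 0) = frag_of []" for s
    proof -
      \<comment> \<open>\<open>k\<close> is the multiplicity of the edge in the last coordinate;
        comparing boundaries forces it to be one.\<close>
      define k where "k = chain_aug (cube_adc n) (susp_out_cell n z s 0)"
      have k: "frag_extend word_aug (susp_out_cell n z s 0) = frag_cmul k (frag_of [])"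
        unfolding k_def by (rule word_aug_chain[OF susp_out_cell_diff(2)[OF z]])
      have "?q s 1 = frag_cmul k (frag_of [Edge])"
        using edge[of s] k by (simp add: frag_extend_cmul)
      then have "frag_cmul k (frag_of [V1] - frag_of [V0]) = frag_of [V1] - frag_of [V0]"
        using nat_cube_cellsD(2)[OF q, of s 0] 3[of True] 3[of False] 
        by (simp add: frag_extend_cmul)
      from arg_cong[OF this, of "\<lambda>c. Poly_Mapping.lookup c [V1]"] have "k = 1"
        by (simp add: lookup_minus)
      then show ?thesis by (simp add: k)
    qed
    show thesis
    proof (rule cell)
      show "?q s 0 = frag_of [endpoint s]" for s by (rule 3)
      show "susp_proj n z = SuspCell (susp_out_cell n z)" using ne by (simp add: susp_proj_def 3)
      show "susp_out_cell n z \<in> cells (nat_cube n)"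
        unfolding nat_cube_cells using susp_out_cell_diff[OF z] aug by blast
    qed
  qed
qed

text \<open>In a 0-composite at most one factor crosses from bottom to top, and the other has zero
  part along the edge, so adding the parts is right. In dimension \<open>Suc j\<close> the shift
  yields composition in dimension \<open>j\<close>.\<close>

lemma strict_functor_susp_proj:
  "strict_functor (susp_proj n) (nat_cube (Suc n)) (suspension (nat_cube n))"
  unfolding strict_functor_def
proof (intro conjI ballI allI impI)
  let ?E = "nat_cube (Suc n)"
  have ne: "frag_of [V0] \<noteq> frag_of [V1]" by (simp add: frag_of_eq)
  fix z assume z: "z \<in> cells ?E"
  show "susp_proj n z \<in> cells (suspension (nat_cube n))"
    using z by (cases rule: susp_proj_cases) auto
  show "susp_proj n (bd ?E s k z) = bd (suspension (nat_cube n)) s k (susp_proj n z)" for s k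
  proof -
    have l: "last_coord n (bd ?E s k z) t 0 = last_coord n z (if k = 0 then s else t) 0" for s k t
      by (simp add: lift_chain_def nat_cube_bd)
    have o: "susp_out_cell n (bd ?E s (Suc k) z) = bd (nat_cube n) s k (susp_out_cell n z)" for k
      by (auto simp: nat_cube_bd fun_eq_iff)
    show ?thesis
      using z
    proof (cases rule: susp_proj_cases)
      case bot
      then show ?thesis unfolding bot(2) by (simp add: susp_proj_def l)
    next
      case top
      then show ?thesis unfolding top(2) using ne by (simp add: susp_proj_def l)
    next
      case cell
      then show ?thesis unfolding cell(2) using ne
        by (cases k) (auto simp: susp_proj_def l o)
    qed
  qed
  fix y k assume y: "y \<in> cells ?E" and c: "tgt ?E k z = src ?E k y"
  have l: "last_coord n (gcomp ?E k z y) t 0 = (if k = 0 \<and> t then last_coord n y t 0 else last_coord n z t 0)" for t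
    by (auto simp: lift_chain_def nat_cube_gcomp[OF c])
  have c0: "k = 0 \<Longrightarrow> last_coord n z True 0 = last_coord n y False 0"
    "0 < k \<Longrightarrow> last_coord n z t 0 = last_coord n y t 0" for t
    using c by (auto simp: nat_cube_composable lift_chain_def)
  show "susp_proj n (gcomp ?E k z y) = gcomp (suspension (nat_cube n)) k (susp_proj n z) (susp_proj n y)"
  proof (cases k)
    case 0
    note c0 = c0(1)[OF 0] and l = l[unfolded 0, simplified]
    have o: "susp_out_cell n (gcomp ?E 0 z y) = (\<lambda>s i. susp_out_cell n z s i + susp_out_cell n y s i)"
      by (auto simp: nat_cube_gcomp[OF c[unfolded 0]] frag_extend_add fun_eq_iff)
    have p: "susp_proj n (gcomp ?E 0 z y) = (if last_coord n y True 0 = frag_of [V0] then Susp0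
        else if last_coord n z False 0 = frag_of [V1] then Susp1
        else SuspCell (\<lambda>s i. susp_out_cell n z s i + susp_out_cell n y s i))"
      unfolding susp_proj_def[of n "gcomp ?E 0 z y"] l o by simp
    \<comment> \<open>Two crossing cells are excluded by \<open>c0\<close> and \<open>ne\<close>:
      the first ends over \<open>V1\<close>, the second starts over \<open>V0\<close>.\<close>
    show ?thesis
      unfolding 0 p
      by (rule susp_proj_cases[OF z]; rule susp_proj_cases[OF y]) (use c0 ne in simp_all)
  next
    case (Suc j)
    have c': "tgt (nat_cube n) j (susp_out_cell n z) = src (nat_cube n) j (susp_out_cell n y)"
      using c by (simp add: nat_cube_composable Suc)
    have o: "susp_out_cell n (gcomp ?E k z y) = gcomp (nat_cube n) j (susp_out_cell n z) (susp_out_cell n y)"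
      unfolding nat_cube_gcomp[OF c'] nat_cube_gcomp[OF c] by (auto simp: Suc frag_extend_add fun_eq_iff)
    have k: "0 < k" using Suc by simp
    show ?thesis
      using c0(2)[OF k] ne unfolding susp_proj_def l o by (auto simp: Suc)
  qed
qed

text \<open>Since \<open>susp_in\<close> raises degrees by one, the degree 0 components are supplied
  separately, as the end vertices of the cube.\<close>

definition susp_incl :: "nat \<Rightarrow> (bool \<Rightarrow> nat \<Rightarrow> (interval list \<Rightarrow>\<^sub>0 int)) susp_cell \<Rightarrow> (bool \<Rightarrow> nat \<Rightarrow> (interval list \<Rightarrow>\<^sub>0 int))" where
  "susp_incl n c = (case c of Susp0 \<Rightarrow> pt0 (nat_cube (Suc n)) | Susp1 \<Rightarrow> pt1 (nat_cube (Suc n))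
     | SuspCell x \<Rightarrow> (\<lambda>s i. case i of 0 \<Rightarrow> frag_of (replicate (Suc n) (endpoint s))
                        | Suc i \<Rightarrow> frag_extend susp_in (x s i)))"

lemma collapse_chain:
  assumes "cube_chain n 0 c"
  shows "frag_extend (collapse s) c = frag_extend (\<lambda>_. frag_of (replicate n (endpoint s))) (frag_extend word_aug c)"
  unfolding frag_extend_frag_extend
  by (rule cube_chain_cong[OF assms]) (auto simp: collapse_eq word_aug_def)

lemma strict_functor_susp_incl:
  "strict_functor (susp_incl n) (suspension (nat_cube n)) (nat_cube (Suc n))"
  unfolding strict_functor_def
proof (intro conjI ballI allI impI)
  let ?E = "nat_cube (Suc n)" and ?S = "suspension (nat_cube n)"
  interpret E: omega_category ?E by (rule nat_cube_omega)
  have pts: "pt0 ?E \<in> cells ?E" "pt1 ?E \<in> cells ?E" "bd ?E s k (pt0 ?E) = pt0 ?E" "bd ?E s k (pt1 ?E) = pt1 ?E" for s k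
    using object_bd[of ?E] nat_cube_bipointed[of "Suc n"] by (auto simp: bipointed_def)
  note bipt = nat_cube_pt[of "Suc n"]
  have cell: "susp_incl n c \<in> cells ?E" if "c \<in> cells ?S" for c
  proof (cases c)
    case (SuspCell x)
    then have x: "x \<in> cells (nat_cube n)" using that by auto
    let ?w = "susp_incl n (SuspCell x)"
    have "cube_chain (Suc n) i (?w s i)" for s i
    proof (cases i)
      case (Suc j)
      have "cube_chain (Suc n) (Suc j) (frag_extend susp_in (x s j))"
        using cube_chain_susp_in by (intro cube_chain_frag_extend[OF nat_cube_cellsD(1)[OF x]]) blast
      then show ?thesis by (simp add: susp_incl_def Suc)
    qed (simp add: susp_incl_def word_deg_vertex)
    \<comment> \<open>For \<open>i = 0\<close> the collapse terms of a chain of augmentation one are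
      the supplied end vertices; for larger \<open>i\<close> they vanish.\<close>
    moreover have "chain_diff (?w s (Suc i)) = ?w True i - ?w False i" for s i
    proof -
      have "chain_diff (frag_extend susp_in (x s i)) = frag_extend susp_in (chain_diff (x s i))
          + (lin_app (frag_extend (collapse True) (x s i)) [V1] - lin_app (frag_extend (collapse False) (x s i)) [V0])"
        by (simp add: frag_extend_frag_extend chain_diff_susp_in frag_extend_fun_add frag_extend_fun_diff)
      moreover have "frag_extend (collapse t) (x s 0) = frag_of (replicate n (endpoint t))" for t
        by (simp add: collapse_chain[OF nat_cube_cellsD(1)[OF x]] nat_cube_cellsD(3)[OF x])
      moreover have "chain_diff (x s 0) = 0"
        using nat_cube_cellsD(1)[OF x, of 0 s]
        by (intro frag_extend_eq_0) (auto simp: cube_chain_def count_list_0_iff intro!: word_diff_vertex)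
      ultimately show ?thesis
        using collapse_pos_deg[OF nat_cube_cellsD(1)[OF x]] nat_cube_cellsD(2)[OF x]
        by (cases i) (auto simp: susp_incl_def frag_extend_diff replicate_append_same)
    qed
    moreover have "frag_extend word_aug (?w s 0) = frag_of []" for s
      by (simp add: susp_incl_def word_aug_def)
    ultimately show ?thesis unfolding nat_cube_cells SuspCell by blast
  qed (simp_all add: susp_incl_def pts)
  fix c assume c: "c \<in> cells ?S"
  show "susp_incl n c \<in> cells ?E" by (rule cell[OF c])
  have bd: "susp_incl n (bd ?S s k c) = bd ?E s k (susp_incl n c)" for c s k
    by (cases c; cases k; cases s)
      (auto simp: susp_incl_def pts nat_cube_bd fun_eq_iff bipt nu_vertex_def split: nat.splits)
  show "susp_incl n (bd ?S s k c) = bd ?E s k (susp_incl n c)" for s k by (rule bd)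
  fix d k assume d: "d \<in> cells ?S" and cd: "tgt ?S k c = src ?S k d"
  have cd': "tgt ?E k (susp_incl n c) = src ?E k (susp_incl n d)"
    using cd bd[of True k c] bd[of False k d] by metis
  show "susp_incl n (gcomp ?S k c d) = gcomp ?E k (susp_incl n c) (susp_incl n d)"
  proof (cases "c = Susp0 \<or> c = Susp1")
    case True
    then have "gcomp ?S k c d = d" "c = src ?S k d" using cd by (cases k; auto)+
    then show ?thesis using E.unit_left[OF cell[OF d], of k] bd[of False k d] by simp
  next
    case c': False
    show ?thesis
    proof (cases "d = Susp0 \<or> d = Susp1")
      case True
      with c' have "gcomp ?S k c d = c" "d = tgt ?S k c" using cd by (cases c; cases k; auto)+
      then show ?thesis using E.unit_right[OF cell[OF c], of k] bd[of True k c] by simp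
    next
      case False
      with c' obtain x y where xy: "c = SuspCell x" "d = SuspCell y" by (cases c; cases d) auto
      with cd obtain j where k: "k = Suc j" and j: "tgt (nat_cube n) j x = src (nat_cube n) j y"
        by (cases k) auto
      have "susp_incl n (SuspCell (gcomp (nat_cube n) j x y)) s i = gcomp ?E k (susp_incl n c) (susp_incl n d) s i" for s i
        unfolding nat_cube_gcomp[OF cd'] nat_cube_gcomp[OF j]
        by (cases i) (auto simp: susp_incl_def xy k frag_extend_add)
      then show ?thesis by (simp add: xy k fun_eq_iff)
    qed
  qed
qed

lemma bip_retract_suspension_cube: "bip_retract (suspension (nat_cube n)) (nat_cube (Suc n))"
proof -
  let ?E = "nat_cube (Suc n)" and ?S = "suspension (nat_cube n)"
  have ne: "frag_of [V0] \<noteq> frag_of [V1]" by (simp add: frag_of_eq)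
  have v: "split_word n proj_right (replicate (Suc n) (endpoint s)) = frag_of [endpoint s]" for s
    unfolding replicate_append_same[symmetric] replicate_Suc by simp
  have p0: "susp_proj n (pt0 ?E) = Susp0" and p1: "susp_proj n (pt1 ?E) = Susp1"
    using v[of False] v[of True] ne
    by (auto simp: susp_proj_def lift_chain_vertex nat_cube_pt simp del: replicate_Suc)
  have "susp_proj n (susp_incl n c) = c" if c: "c \<in> cells ?S" for c
  proof (cases c)
    case (SuspCell x)
    then have x: "x \<in> cells (nat_cube n)" using c by auto
    have "frag_extend (susp_out n) (frag_extend susp_in (x s i)) = x s i" for s i
    proof -
      have "frag_extend (susp_out n) (frag_extend susp_in (x s i)) = frag_extend frag_of (x s i)"
        unfolding frag_extend_frag_extend
        by (rule cube_chain_cong[OF nat_cube_cellsD(1)[OF x] susp_out_susp_in])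
      then show ?thesis by (simp add: frag_extend_frag_of)
    qed
    \<comment> \<open>The included cell runs from the first to the last vertex, so
      \<open>susp_proj\<close> takes its third case.\<close>
    moreover have "last_coord n (susp_incl n c) s 0 = frag_of [endpoint s]" for s
      using v[of s] by (simp add: lift_chain_def susp_incl_def SuspCell del: replicate_Suc)
    ultimately show ?thesis using ne by (simp add: susp_proj_def) (simp add: susp_incl_def SuspCell)
  qed (simp_all add: susp_incl_def p0 p1)
  moreover have "bip_functor (susp_incl n) ?S ?E"
    using strict_functor_susp_incl by (simp add: bip_functor_def susp_incl_def)
  moreover have "bip_functor (susp_proj n) ?E ?S"
    using strict_functor_susp_proj by (simp add: bip_functor_def p0 p1)
  ultimately show ?thesis unfolding bip_retract_def by blast
qed

theorem corollary3p3:
  fixes X :: "'a bip_omega" and Y :: "'b bip_omega"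
  shows "(nat_cube_idem_completion X \<longrightarrow> nat_cube_idem_completion (suspension X)) \<and>
         (nat_cube_idem_completion X \<and> nat_cube_idem_completion Y \<longrightarrow> nat_cube_idem_completion (wedge X Y))"
proof (intro conjI impI)
  assume "nat_cube_idem_completion X"
  then obtain n where "bipointed X" "bip_retract X (nat_cube n)"
    unfolding nat_cube_idem_completion_def by blast
  then show "nat_cube_idem_completion (suspension X)"
    unfolding nat_cube_idem_completion_def
    using suspension_bipointed bip_retract_trans[OF bip_retract_suspension bip_retract_suspension_cube]
    by (auto simp: bipointed_def)
next
  assume "nat_cube_idem_completion X \<and> nat_cube_idem_completion Y"
  then obtain m n where "bipointed X" "bip_retract X (nat_cube m)" "bipointed Y" "bip_retract Y (nat_cube n)"
    unfolding nat_cube_idem_completion_def by blast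
  then show "nat_cube_idem_completion (wedge X Y)"
    unfolding nat_cube_idem_completion_def
    using wedge_bipointed bip_retract_trans[OF bip_retract_wedge bip_retract_wedge_cubes] nat_cube_bipointed
    by metis
qed

end
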